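(* For every positive integer $n$, there exists a covering path of $G_n^2$ whose link length equals the minimum link length of a covering trail of $G_n^2$. Moreover, if $n=2m$ for some positive integer $m$, then there exists a covering cycle of $G_n^2$ whose link length equals the minimum link length of a covering trail of $G_n^2$.
   Context: For a positive integer $n$, let $G_n^2=\{0,1,\ldots,n-1\}\times\{0,1,\ldots,n-1\}\subset\mathbb{R}^2$. A covering trail of $G_n^2$ is a directed polygonal chain in $\mathbb{R}^2$ (a finite sequence of points, consecutive ones joined by line segments called edges) that passes through every point of $G_n^2$ at least once, in which no edge is repeated and no two consecutive edges are collinear; its vertices need not be grid points. A covering path is a covering trail that passes through each point of $G_n^2$ exactly once (points not in $G_n^2$ may be passed through several times). A covering circuit is a covering trail whose starting point equals its endpoint. A covering cycle is a closed covering path, i.e. a covering circuit (possibly self-crossing) in which every point of $G_n^2$ is passed through exactly once, except that the starting point, if it is a grid point, is counted both at the start and at the end. The link length of a trail is its number of edges. It is known that the minimum link length of a covering trail of $G_n^2$ is $1$ for $n=1$, $3$ for $n=2$, and $2(n-1)$ for $n\ge 3$. *)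

theory Defs
  imports "HOL-Analysis.Analysis"
begin

definition grid :: "nat \<Rightarrow> (real \<times> real) set" where
  "grid n = {(real i, real j) | i j. i < n \<and> j < n}"

text \<open>A polygonal chain is given by the list of its vertices, in the order of traversal.\<close>

type_synonym chain = "(real \<times> real) list"

definition link_length :: "chain \<Rightarrow> nat" where
  "link_length vs = length vs - 1"

definition edge :: "chain \<Rightarrow> nat \<Rightarrow> (real \<times> real) set" where
  "edge vs i = closed_segment (vs ! i) (vs ! Suc i)"

text \<open>The chain is parametrised over the interval from 0 to its link length, the \<open>i\<close>-th edge being
  traversed at unit parameter speed during the interval from \<open>i\<close> to \<open>i + 1\<close>. In particular a
  passage through the common vertex of two consecutive edges yields a single parameter.\<close>

definition pass_times :: "chain \<Rightarrow> real \<times> real \<Rightarrow> real set" where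
  "pass_times vs p =
     {real i + s | i s. i < link_length vs \<and> s \<in> {0..1} \<and> linepath (vs ! i) (vs ! Suc i) s = p}"

definition covering_trail :: "nat \<Rightarrow> chain \<Rightarrow> bool" where
  "covering_trail n vs \<longleftrightarrow>
     length vs \<ge> 2 \<and>
     (\<forall>i < link_length vs. vs ! i \<noteq> vs ! Suc i) \<and>
     (\<forall>p \<in> grid n. pass_times vs p \<noteq> {}) \<and>
     inj_on (edge vs) {..<link_length vs} \<and>
     (\<forall>i. Suc i < link_length vs \<longrightarrow> \<not> collinear (edge vs i \<union> edge vs (Suc i)))"

definition covering_path :: "nat \<Rightarrow> chain \<Rightarrow> bool" where
  "covering_path n vs \<longleftrightarrow>
     covering_trail n vs \<and> (\<forall>p \<in> grid n. card (pass_times vs p) = 1)"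

definition covering_circuit :: "nat \<Rightarrow> chain \<Rightarrow> bool" where
  "covering_circuit n vs \<longleftrightarrow> covering_trail n vs \<and> hd vs = last vs"

text \<open>If the starting point is a grid point, it is passed at the first and at the last parameter
  and at no other one.\<close>

definition covering_cycle :: "nat \<Rightarrow> chain \<Rightarrow> bool" where
  "covering_cycle n vs \<longleftrightarrow>
     covering_circuit n vs \<and>
     (\<forall>p \<in> grid n. card (pass_times vs p) = (if p = hd vs then 2 else 1))"

definition min_link_length :: "nat \<Rightarrow> nat" where
  "min_link_length n = (LEAST k. \<exists>vs. covering_trail n vs \<and> link_length vs = k)"

end

theory Submission
  imports Defs
begin

text \<open>A trail in which every row contains a horizontal edge has \<open>n\<close> of them, no two of them
  consecutive, and similarly for columns. Otherwise let \<open>a\<close> rows and \<open>b\<close> columns be missed by the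
  horizontal and vertical edges. A slanted edge passes at most two points of the frame of the
  \<open>a\<close> by \<open>b\<close> subgrid that they form, so that there are at least \<open>a + b - 2\<close> slanted edges.

  The optimal chains are billiard trajectories. In a box of \<open>b\<close> columns, \<open>b\<close> even, lines of slope \<open>1\<close>
  and \<open>- 1\<close> of fixed parity pass each grid point exactly once and cross between grid points. They are
  reflected halfway between the last column of the box and the next one, and extended above and
  below the grid until they meet the lines through the remaining columns, which can be traversed
  there without passing further grid points. With about \<open>n / 2\<close> columns in the box all trajectories
  are short, and the vertical lines link them into a single chain.\<close>

section \<open>Lower bound\<close>

text \<open>The frame has \<open>2 * a + 2 * b - 4\<close> points, and besides the slanted edges
  there are at least \<open>n - a\<close> horizontal and \<open>n - b\<close> vertical ones, so the
  total \<open>2 * n - 2\<close> does not depend on \<open>a\<close> and \<open>b\<close>. For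
  \<open>n = 2\<close> the count would admit the two diagonals of the square, but two edges with a
  common end cannot contain both; hence the separate value \<open>3\<close>. The boxes turn this
  count into an equality. If \<open>n\<close> and \<open>b\<close> are even, exactly
  \<open>n + b - 2\<close> lines of the fixed parity meet the grid inside the box, so together with
  the \<open>n - b\<close> vertical lines there are \<open>2 * n - 2\<close> lines that share no
  grid point of their own, and what remains is to traverse them in a single chain. If
  \<open>n\<close> is odd and \<open>b\<close> even, there are \<open>n + b - 1\<close> such lines,
  one too many: this is the obstacle for odd \<open>n\<close>.\<close>

definition cross :: "real \<times> real \<Rightarrow> real \<times> real \<Rightarrow> real" where
  "cross u v = fst u * snd v - snd u * fst v"

section \<open>Counting the lines of a cover of the grid\<close>

lemma card_no_consecutive:
  assumes "H \<subseteq> {..<K}" and "\<And>i. i \<in> H \<Longrightarrow> Suc i \<notin> H"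
  shows "2 * card H \<le> Suc K"
proof -
  have fin: "finite H" using assms(1) finite_subset by blast
  \<comment> \<open>The shifted set is disjoint from \<open>H\<close> and still lies in
    \<open>{..K}\<close>, which has \<open>Suc K\<close> elements.\<close>
  have "H \<inter> Suc ` H = {}" using assms(2) by auto
  then have "card (H \<union> Suc ` H) = 2 * card H"
    using fin by (simp add: card_Un_disjoint card_image)
  moreover have "H \<union> Suc ` H \<subseteq> {..K}" using assms(1) by auto
  then have "card (H \<union> Suc ` H) \<le> Suc K"
    using card_mono[of "{..K}"] by fastforce
  ultimately show ?thesis by simp
qed

text \<open>Each member serves a single value of \<open>c\<close>. With a coordinate for
  \<open>c\<close>, this bounds the number of rows or columns met by horizontal or vertical
  members.\<close>

lemma card_le_lines:
  fixes c :: "real \<times> real \<Rightarrow> real" and S :: "'i \<Rightarrow> (real \<times> real) set"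
  assumes "finite J" and "finite Y" and "\<And>j p q. j \<in> J \<Longrightarrow> p \<in> S j \<Longrightarrow> q \<in> S j \<Longrightarrow> c p = c q"
    and "\<And>y. y \<in> Y \<Longrightarrow> \<exists>j\<in>J. \<exists>p\<in>S j. c p = real y"
  shows "card Y \<le> card J"
proof -
  obtain g where g: "\<And>y. y \<in> Y \<Longrightarrow> g y \<in> J \<and> (\<exists>p\<in>S (g y). c p = real y)"
    using assms(4) by metis
  have "inj_on g Y"
  proof (rule inj_onI)
    fix y z assume "y \<in> Y" "z \<in> Y" "g y = g z"
    then show "y = z" using g[of y] g[of z] assms(3) by (metis of_nat_eq_iff)
  qed
  moreover have "g ` Y \<subseteq> J" using g by blast
  ultimately show ?thesis using assms(1) card_inj_on_le by blast
qed

text \<open>The two horizontal and the two vertical sides share four corners, which are distinct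
  since each set has at least two elements. The additive form avoids subtraction of natural
  numbers.\<close>

lemma card_frame:
  fixes A B :: "nat set"
  assumes "finite A" "finite B" "2 \<le> card A" "2 \<le> card B"
  shows "card (B \<times> {Min A, Max A} \<union> {Min B, Max B} \<times> A) + 4 = 2 * card A + 2 * card B"
proof -
  have ne: "A \<noteq> {}" "B \<noteq> {}" using assms by auto
  have two: "Min X \<noteq> Max X" if "finite X" "2 \<le> card X" for X :: "nat set"
  proof
    assume eq: "Min X = Max X"
    have "X \<subseteq> {Min X}"
      using that eq by (metis Max_ge Min_le insertCI le_antisym subsetI)
    then have "card X \<le> 1" using card_mono[of "{Min X}" X] by simp
    then show False using that by simp
  qed
  let ?P = "B \<times> {Min A, Max A}" and ?Q = "{Min B, Max B} \<times> A"
  have "Min A \<in> A" "Max A \<in> A" "Min B \<in> B" "Max B \<in> B" using assms ne by auto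
  then have "?P \<inter> ?Q = {Min B, Max B} \<times> {Min A, Max A}" by auto
  then have "card (?P \<inter> ?Q) = 4"
    using two[of A] two[of B] assms by (simp add: card_cartesian_product)
  moreover have "card ?P = 2 * card B" "card ?Q = 2 * card A"
    using two[of A] two[of B] assms by (simp_all add: card_cartesian_product)
  moreover have "card ?P + card ?Q = card (?P \<union> ?Q) + card (?P \<inter> ?Q)"
    by (rule card_Un_Int) (use assms in simp_all)
  ultimately show ?thesis by linarith
qed

text \<open>Both coordinates are strictly monotone along a slanted line. Of three points on it, the
  middle one lies strictly inside the rectangle, hence off the frame.\<close>

lemma slanted_frame_le_2:
  fixes A B :: "nat set" and T :: "(nat \<times> nat) set"
  assumes "finite A" "finite B"
    and T: "T \<subseteq> B \<times> {Min A, Max A} \<union> {Min B, Max B} \<times> A"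
    and "A \<noteq> {}" "B \<noteq> {}"
    and d: "fst d \<noteq> 0" "snd d \<noteq> 0"
    and line: "\<And>x y x' y'. (x, y) \<in> T \<Longrightarrow> (x', y') \<in> T \<Longrightarrow>
      cross (real x' - real x, real y' - real y) d = 0"
  shows "card T \<le> 2"
proof (rule ccontr)
  assume "\<not> card T \<le> 2"
  then have c3: "3 \<le> card T" by simp
  then have finT: "finite T" using card.infinite by fastforce
  have "Min A \<in> A" "Max A \<in> A" "Min B \<in> B" "Max B \<in> B" using assms(1,2,4,5) by auto
  then have "T \<subseteq> B \<times> A" using T by auto
  then have AB: "x \<in> B" "y \<in> A" if "(x, y) \<in> T" for x y
    using that by auto
  have inj: "inj_on fst T"
  proof (rule inj_onI, clarify)
    fix x y x' y' assume "(x, y) \<in> T" "(x', y') \<in> T" "fst (x, y) = fst (x', y')"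
    then show "x = x' \<and> y = y'" using line[of x y x' y'] d by (auto simp: cross_def)
  qed
  let ?X = "fst ` T"
  have X3: "card ?X = card T" using inj by (simp add: card_image)
  have finX: "finite ?X" using finT by simp
  have "?X - {Min ?X, Max ?X} \<noteq> {}"
  proof
    assume "?X - {Min ?X, Max ?X} = {}"
    then have "card ?X \<le> card {Min ?X, Max ?X}" by (intro card_mono) auto
    also have "\<dots> \<le> 2" by (simp add: card_insert_if)
    finally show False using X3 c3 by simp
  qed
  \<comment> \<open>Since \<open>fst\<close> is injective on \<open>T\<close>, a third point has an
    abscissa strictly between two others.\<close>
  then obtain x1 where x1: "x1 \<in> ?X" "x1 \<noteq> Min ?X" "x1 \<noteq> Max ?X" by blast
  have neX: "?X \<noteq> {}" using x1 by blast
  obtain y1 where t1: "(x1, y1) \<in> T" using x1 by auto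
  obtain x0 y0 where t0: "(x0, y0) \<in> T" and l0: "x0 < x1"
    using x1 finX neX Min_in[of ?X] Min_le[of ?X x1] by (metis image_iff order_less_le prod.collapse)
  obtain x2 y2 where t2: "(x2, y2) \<in> T" and l2: "x1 < x2"
    using x1 finX neX Max_in[of ?X] Max_ge[of ?X x1] by (metis image_iff order_less_le prod.collapse)
  have e0: "(real x1 - real x0) * snd d = (real y1 - real y0) * fst d"
    and e2: "(real x2 - real x1) * snd d = (real y2 - real y1) * fst d"
    using line[OF t0 t1] line[OF t1 t2] by (auto simp: cross_def)
  define m where "m = snd d / fst d"
  have m: "m \<noteq> 0" "real y1 - real y0 = (real x1 - real x0) * m" "real y2 - real y1 = (real x2 - real x1) * m"
    using d e0 e2 by (auto simp: m_def field_simps)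
  have mid: "y0 < y1 \<and> y1 < y2 \<or> y2 < y1 \<and> y1 < y0"
  proof (cases "m > 0")
    case True
    then have "(real x1 - real x0) * m > 0" "(real x2 - real x1) * m > 0" using l0 l2 by simp_all
    then show ?thesis using m by simp
  next
    case False
    then have "(real x1 - real x0) * m < 0" "(real x2 - real x1) * m < 0"
      using l0 l2 m(1) by (simp_all add: mult_pos_neg)
    then show ?thesis using m by simp
  qed
  have "Min A < y1 \<and> y1 < Max A"
    using mid AB[OF t0] AB[OF t2] assms(1) by (meson Max_ge Min_le less_le_trans le_less_trans)
  moreover have "Min B < x1 \<and> x1 < Max B"
    using l0 l2 AB[OF t0] AB[OF t2] assms(2) by (meson Max_ge Min_le less_le_trans le_less_trans)
  ultimately show False using T t1 by auto
qed

definition free_rows where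
  "free_rows n I S d = {y. y < n \<and> (\<forall>j\<in>I. snd (d j) = (0::real) \<longrightarrow> (\<forall>p\<in>S j. snd p \<noteq> real y))}"

definition free_cols where
  "free_cols n I S d = {x. x < n \<and> (\<forall>j\<in>I. fst (d j) = (0::real) \<longrightarrow> (\<forall>p\<in>S j. fst p \<noteq> real x))}"

text \<open>The sets \<open>S j\<close> need only lie on lines, so that the lemma applies to the
  edges of a trail and also to sets of grid points that share a key. Only slanted members meet the
  product of free rows and free columns. If this product has a single row or column, each slanted
  member meets at most one of its points, which improves the bound by one.\<close>

lemma line_cover_lower_bound:
  fixes I :: "'i set" and S :: "'i \<Rightarrow> (real \<times> real) set" and d :: "'i \<Rightarrow> real \<times> real"
  assumes finI: "finite I" and d: "\<And>j. j \<in> I \<Longrightarrow> d j \<noteq> 0"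
    and line: "\<And>j p q. j \<in> I \<Longrightarrow> p \<in> S j \<Longrightarrow> q \<in> S j \<Longrightarrow> cross (q - p) (d j) = 0"
    and cov: "grid n \<subseteq> (\<Union>j\<in>I. S j)"
    and neA: "free_rows n I S d \<noteq> {}" and neB: "free_cols n I S d \<noteq> {}"
  shows "2 * n \<le> card I + 2"
    and "card (free_rows n I S d) = 1 \<or> card (free_cols n I S d) = 1 \<Longrightarrow> 2 * n \<le> card I + 1"
proof -
  let ?A = "free_rows n I S d" and ?B = "free_cols n I S d"
  define H where "H = {j\<in>I. snd (d j) = 0}"
  define W where "W = {j\<in>I. fst (d j) = 0}"
  define R where "R = {j\<in>I. fst (d j) \<noteq> 0 \<and> snd (d j) \<noteq> 0}"
  have fin: "finite ?A" "finite ?B" "finite H" "finite W" "finite R"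
    using finI by (auto simp: free_rows_def free_cols_def H_def W_def R_def)
  have "H \<inter> W = {}" using d by (auto simp: H_def W_def zero_prod_def prod_eq_iff)
  then have "card (H \<union> W) = card H + card W" using fin by (simp add: card_Un_disjoint)
  moreover have "(H \<union> W) \<inter> R = {}" "I = (H \<union> W) \<union> R" by (auto simp: H_def W_def R_def)
  then have "card I = card (H \<union> W) + card R" using fin by (simp add: card_Un_disjoint)
  ultimately have cI: "card I = card H + card W + card R" by simp
  have sndH: "snd p = snd q" if "j \<in> H" "p \<in> S j" "q \<in> S j" for j p q
    using that line[of j p q] d[of j] by (auto simp: H_def cross_def zero_prod_def prod_eq_iff)
  have fstW: "fst p = fst q" if "j \<in> W" "p \<in> S j" "q \<in> S j" for j p q
    using that line[of j p q] d[of j] by (auto simp: W_def cross_def zero_prod_def prod_eq_iff)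
  have "card ({..<n} - ?A) \<le> card H"
  proof (rule card_le_lines[where c = snd and S = S])
    show "snd p = snd q" if "j \<in> H" "p \<in> S j" "q \<in> S j" for j p q by (rule sndH[OF that])
  qed (use fin in \<open>auto simp: free_rows_def H_def\<close>)
  moreover have "?A \<subseteq> {..<n}" by (auto simp: free_rows_def)
  then have "card ({..<n} - ?A) = n - card ?A" using fin by (simp add: card_Diff_subset)
  ultimately have cH: "n \<le> card H + card ?A" by simp
  have "card ({..<n} - ?B) \<le> card W"
  proof (rule card_le_lines[where c = fst and S = S])
    show "fst p = fst q" if "j \<in> W" "p \<in> S j" "q \<in> S j" for j p q by (rule fstW[OF that])
  qed (use fin in \<open>auto simp: free_cols_def W_def\<close>)
  moreover have "?B \<subseteq> {..<n}" by (auto simp: free_cols_def)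
  then have "card ({..<n} - ?B) = n - card ?B" using fin by (simp add: card_Diff_subset)
  ultimately have cW: "n \<le> card W + card ?B" by simp
  define pt where "pt = (\<lambda>(x, y). (real x, real y))"
  \<comment> \<open>A point of a free row and a free column lies on no horizontal and no vertical
    member.\<close>
  have inR: "\<exists>j\<in>R. pt q \<in> S j" if "q \<in> ?B \<times> ?A" for q
  proof -
    have "pt q \<in> grid n" using that by (auto simp: pt_def grid_def free_rows_def free_cols_def)
    then obtain j where j: "j \<in> I" "pt q \<in> S j" using cov by blast
    have "snd (d j) \<noteq> 0" "fst (d j) \<noteq> 0"
      using that j by (fastforce simp: free_rows_def free_cols_def pt_def)+
    then show ?thesis using j by (auto simp: R_def)
  qed
  have bound: "card T \<le> c * card R"
    if "T \<subseteq> ?B \<times> ?A" "\<And>j. j \<in> R \<Longrightarrow> card {q\<in>T. pt q \<in> S j} \<le> c" for T c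
  proof -
    have finT: "finite T" using that(1) fin by (meson finite_SigmaI finite_subset)
    have "T = (\<Union>j\<in>R. {q\<in>T. pt q \<in> S j})" using inR that(1) by blast
    then have "card T \<le> (\<Sum>j\<in>R. card {q\<in>T. pt q \<in> S j})"
      using card_UN_le[OF fin(5), of "\<lambda>j. {q\<in>T. pt q \<in> S j}"] by simp
    also have "\<dots> \<le> (\<Sum>j\<in>R. c)" using that(2) by (rule sum_mono)
    finally show ?thesis by (simp add: mult.commute)
  qed
  have R: "cross (real x' - real x, real y' - real y) (d j) = 0" 
    if "j \<in> R" "pt (x, y) \<in> S j" "pt (x', y') \<in> S j" for j x y x' y'
    using line[of j "pt (x, y)" "pt (x', y')"] that by (simp add: R_def pt_def)
  have one: "card {q\<in>?B \<times> ?A. pt q \<in> S j} \<le> 1" if "card ?A = 1 \<or> card ?B = 1" "j \<in> R" for j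
  proof -
    have "q = q'" if q: "q \<in> {q\<in>?B \<times> ?A. pt q \<in> S j}" "q' \<in> {q\<in>?B \<times> ?A. pt q \<in> S j}" for q q'
    proof -
      obtain x y x' y' where xy: "q = (x, y)" "q' = (x', y')" by (metis prod.collapse)
      have "x = x' \<or> y = y'" using q xy \<open>card ?A = 1 \<or> card ?B = 1\<close> by (auto simp: card_1_singleton_iff)
      then show ?thesis using R[OF \<open>j \<in> R\<close>, of x y x' y'] q xy \<open>j \<in> R\<close> by (auto simp: cross_def R_def)
    qed
    then show ?thesis by (metis (no_types, lifting) card_le_Suc0_iff_eq One_nat_def card.infinite zero_le)
  qed
  have cAB: "card ?A \<ge> 1" "card ?B \<ge> 1" using neA neB fin by (simp_all add: Suc_le_eq card_gt_0_iff)
  show thin: "2 * n \<le> card I + 1" if "card ?A = 1 \<or> card ?B = 1"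
  proof -
    have "card (?B \<times> ?A) \<le> 1 * card R" using one that by (intro bound) auto
    \<comment> \<open>One factor is \<open>1\<close>, so the product is
      \<open>card ?A + card ?B - 1\<close>.\<close>
    then have "card ?A + card ?B \<le> card R + 1" using that by (auto simp: card_cartesian_product)
    then show ?thesis using cH cW cI by linarith
  qed
  show "2 * n \<le> card I + 2"
  proof (cases "card ?A = 1 \<or> card ?B = 1")
    case True
    then show ?thesis using thin by linarith
  next
    case False
    then have c2: "2 \<le> card ?A" "2 \<le> card ?B" using cAB by linarith+
    let ?T = "?B \<times> {Min ?A, Max ?A} \<union> {Min ?B, Max ?B} \<times> ?A"
    have "Min ?A \<in> ?A" "Max ?A \<in> ?A" "Min ?B \<in> ?B" "Max ?B \<in> ?B" using fin neA neB by auto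
    then have "?T \<subseteq> ?B \<times> ?A" by auto
    moreover have "card {q\<in>?T. pt q \<in> S j} \<le> 2" if "j \<in> R" for j
      by (rule slanted_frame_le_2[of ?A ?B _ "d j"]) (use fin neA neB R that in \<open>auto simp: R_def\<close>)
    ultimately have "card ?T \<le> 2 * card R" by (rule bound)
    then show ?thesis using card_frame[OF fin(1,2) c2] cH cW cI by linarith
  qed
qed

section \<open>The bound for trails\<close>

lemma cross_scaleR [simp]:
  "cross (c *\<^sub>R u) v = c * cross u v" "cross u (c *\<^sub>R v) = c * cross u v"
  by (simp_all add: cross_def algebra_simps)

lemma cross_self [simp]: "cross u u = 0"
  by (simp add: cross_def)

lemma cross_diff_right: "cross u (v - w) = cross u v - cross u w"
  by (simp add: cross_def algebra_simps)

lemma closed_segmentE: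
  fixes p :: "real \<times> real"
  assumes "p \<in> closed_segment a b"
  obtains u where "0 \<le> u" "u \<le> 1" "p - a = u *\<^sub>R (b - a)" "p - b = (u - 1) *\<^sub>R (b - a)"
  using assms unfolding in_segment by (auto simp: algebra_simps)

lemma cross_closed_segment:
  assumes "p \<in> closed_segment a b" "q \<in> closed_segment a b"
  shows "cross (q - p) (b - a) = 0"
proof -
  obtain u where u: "p - a = u *\<^sub>R (b - a)" using assms(1) by (rule closed_segmentE)
  obtain t where t: "q - a = t *\<^sub>R (b - a)" using assms(2) by (rule closed_segmentE)
  have "q - p = (q - a) - (p - a)" by simp
  also have "\<dots> = (t - u) *\<^sub>R (b - a)" unfolding t u by (simp add: algebra_simps)
  finally show ?thesis by simp
qed

text \<open>All points of the two edges differ from the common vertex by multiples of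
  \<open>d\<close>. With the unit vectors for \<open>d\<close> this forbids consecutive horizontal
  or vertical edges.\<close>

lemma not_consecutive_parallel:
  assumes trail: "covering_trail n vs" and i: "Suc i < link_length vs"
    and d: "d \<noteq> 0" "cross d (vs ! Suc i - vs ! i) = 0" "cross d (vs ! Suc (Suc i) - vs ! Suc i) = 0"
  shows False
proof -
  have "\<exists>c. x - y = c *\<^sub>R d" if "cross d (x - y) = 0" for x y
  proof (cases "fst d = 0")
    case True
    then have "x - y = (snd (x - y) / snd d) *\<^sub>R d"
      using that d(1) by (auto simp: cross_def prod_eq_iff zero_prod_def)
    then show ?thesis by blast
  next
    case False
    then have "x - y = (fst (x - y) / fst d) *\<^sub>R d"
      using that d(1) by (auto simp: cross_def prod_eq_iff field_simps)
    then show ?thesis by blast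
  qed
  moreover have on: "cross d (x - vs ! Suc i) = 0" if "x \<in> edge vs i \<union> edge vs (Suc i)" for x
    using that d(2,3) by (auto simp: edge_def elim!: closed_segmentE)
  have "cross d (x - y) = 0"
    if "x \<in> edge vs i \<union> edge vs (Suc i)" "y \<in> edge vs i \<union> edge vs (Suc i)" for x y
    using on[OF that(1)] on[OF that(2)] by (simp add: cross_diff_right)
  ultimately have "collinear (edge vs i \<union> edge vs (Suc i))"
    unfolding collinear_def by blast
  then show False using trail i by (auto simp: covering_trail_def)
qed

lemma grid_subset_edges:
  assumes "covering_trail n vs"
  shows "grid n \<subseteq> (\<Union>i<link_length vs. edge vs i)"
proof
  fix p assume "p \<in> grid n"
  then have "pass_times vs p \<noteq> {}" using assms by (auto simp: covering_trail_def)
  then obtain i s where i: "i < link_length vs"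
    and s: "s \<in> {0..1}" "linepath (vs ! i) (vs ! Suc i) s = p"
    by (auto simp: pass_times_def)
  have "p \<in> edge vs i"
    unfolding edge_def using s linepath_in_path by blast
  then show "p \<in> (\<Union>i<link_length vs. edge vs i)" using i by blast
qed

text \<open>Without a free row there are \<open>n\<close> horizontal edges, no two consecutive,
  whence at least \<open>2 * n - 1\<close> edges; likewise for columns. The value
  \<open>2 * n - 2\<close> is left only when two rows and two columns are free, and this extra
  information is what settles \<open>n = 2\<close>.\<close>

lemma trail_cases:
  assumes trail: "covering_trail n vs"
  defines "d \<equiv> \<lambda>i. vs ! Suc i - vs ! i" and "K \<equiv> link_length vs"
  defines "A \<equiv> free_rows n {..<K} (edge vs) d" and "B \<equiv> free_cols n {..<K} (edge vs) d"
  shows "2 * n \<le> Suc K \<or> (2 \<le> card A \<and> 2 \<le> card B \<and> 2 * n \<le> K + 2)"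
proof -
  have d0: "d j \<noteq> 0" if "j \<in> {..<K}" for j
    using that trail by (auto simp: d_def K_def covering_trail_def)
  have line: "cross (q - p) (d j) = 0" if "p \<in> edge vs j" "q \<in> edge vs j" for p q j
    using that cross_closed_segment by (auto simp: edge_def d_def)
  have cov: "grid n \<subseteq> (\<Union>j\<in>{..<K}. edge vs j)"
    using grid_subset_edges[OF trail] by (simp add: K_def)
  have fin: "finite A" "finite B" by (auto simp: A_def B_def free_rows_def free_cols_def)
  show ?thesis
  proof (cases "A = {} \<or> B = {}")
    case False
    then have 1: "2 * n \<le> K + 2" "card A = 1 \<or> card B = 1 \<Longrightarrow> 2 * n \<le> K + 1"
      using line_cover_lower_bound[OF _ d0 line cov] by (auto simp: A_def B_def)
    have "card A \<noteq> 0" "card B \<noteq> 0" using False fin by auto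
    then show ?thesis using 1 by linarith
  next
    case True
    then show ?thesis
    proof
      assume A: "A = {}"
      define H where "H = {j\<in>{..<K}. snd (d j) = 0}"
      have "n = card {..<n}" by simp
      also have "\<dots> \<le> card H"
      proof (rule card_le_lines[where c = snd and S = "edge vs"])
        show "snd p = snd q" if "j \<in> H" "p \<in> edge vs j" "q \<in> edge vs j" for j p q
          using line[OF that(2,3)] d0[of j] that(1)
          by (auto simp: H_def cross_def prod_eq_iff zero_prod_def)
        show "\<exists>j\<in>H. \<exists>p\<in>edge vs j. snd p = real y" if "y \<in> {..<n}" for y
          using A that unfolding A_def free_rows_def H_def by blast
      qed (auto simp: H_def)
      also have "2 * card H \<le> Suc K"
      proof (rule card_no_consecutive)
        show "Suc i \<notin> H" if "i \<in> H" for i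
          using that not_consecutive_parallel[OF trail, of i "(1, 0)"]
          by (auto simp: H_def K_def d_def cross_def zero_prod_def)
      qed (auto simp: H_def)
      finally show ?thesis by linarith
    next
      assume B: "B = {}"
      define H where "H = {j\<in>{..<K}. fst (d j) = 0}"
      have "n = card {..<n}" by simp
      also have "\<dots> \<le> card H"
      proof (rule card_le_lines[where c = fst and S = "edge vs"])
        show "fst p = fst q" if "j \<in> H" "p \<in> edge vs j" "q \<in> edge vs j" for j p q
          using line[OF that(2,3)] d0[of j] that(1)
          by (auto simp: H_def cross_def prod_eq_iff zero_prod_def)
        show "\<exists>j\<in>H. \<exists>p\<in>edge vs j. fst p = real x" if "x \<in> {..<n}" for x
          using B that unfolding B_def free_cols_def H_def by blast
      qed (auto simp: H_def)
      also have "2 * card H \<le> Suc K"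
      proof (rule card_no_consecutive)
        show "Suc i \<notin> H" if "i \<in> H" for i
          using that not_consecutive_parallel[OF trail, of i "(0, 1)"]
          by (auto simp: H_def K_def d_def cross_def zero_prod_def)
      qed (auto simp: H_def)
      finally show ?thesis by linarith
    qed
  qed
qed

text \<open>With two edges, all rows and columns are free, so no edge contains two neighbouring grid
  points and the edges contain the two diagonals. Their common vertex must then be the crossing
  point, but an edge that ends there cannot contain both ends of a diagonal.\<close>

lemma trail_2_ge_3:
  assumes trail: "covering_trail 2 vs"
  shows "3 \<le> link_length vs"
proof (rule ccontr)
  let ?K = "link_length vs"
  let ?d = "\<lambda>i. vs ! Suc i - vs ! i"
  let ?A = "free_rows 2 {..<?K} (edge vs) ?d" and ?B = "free_cols 2 {..<?K} (edge vs) ?d"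
  assume "\<not> 3 \<le> ?K"
  then have c: "2 \<le> card ?A" "2 \<le> card ?B" and K: "?K = 2"
    using trail_cases[OF trail] by auto
  have full: "X = {..<2}" if "X \<subseteq> {..<2}" "2 \<le> card X" for X :: "nat set"
    using that by (metis card_lessThan card_seteq finite_lessThan)
  have AB: "?A = {..<2}" "?B = {..<2}"
    by (rule full; use c in \<open>auto simp: free_rows_def free_cols_def\<close>)+
  have slanted: "fst (?d j) \<noteq> 0" "snd (?d j) \<noteq> 0"
    if "j < 2" "(real x, real y) \<in> edge vs j" "x < 2" "y < 2" for j x y
  proof -
    have "x \<in> ?B" "y \<in> ?A" using AB that by auto
    then show "fst (?d j) \<noteq> 0" "snd (?d j) \<noteq> 0"
      using that K unfolding free_rows_def free_cols_def by fastforce+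
  qed
  have line: "cross (q - p) (?d j) = 0" if "p \<in> edge vs j" "q \<in> edge vs j" for p q j
    using that cross_closed_segment by (auto simp: edge_def)
  have row: "\<not> ((0, y) \<in> edge vs j \<and> (1, y) \<in> edge vs j)" if "j < 2" "y \<in> {0, 1}" for j y
    using line[of "(0, y)" j "(1, y)"] slanted[of j 0 "nat \<lfloor>y\<rfloor>"] that by (auto simp: cross_def)
  have col: "\<not> ((x, 0) \<in> edge vs j \<and> (x, 1) \<in> edge vs j)" if "j < 2" "x \<in> {0, 1}" for j x
    using line[of "(x, 0)" j "(x, 1)"] slanted[of j "nat \<lfloor>x\<rfloor>" 0] that by (auto simp: cross_def)
  have "(real x, real y) \<in> edge vs 0 \<union> edge vs 1" if "x < 2" "y < 2" for x y
  proof -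
    have "(real x, real y) \<in> grid 2" using that by (auto simp: grid_def)
    then show ?thesis using grid_subset_edges[OF trail] K by (auto simp: less_2_cases_iff)
  qed
  from this[of 0 0] this[of 0 1] this[of 1 0] this[of 1 1]
  have in4: "(0, 0) \<in> edge vs 0 \<union> edge vs 1" "(0, 1) \<in> edge vs 0 \<union> edge vs 1"
    "(1, 0) \<in> edge vs 0 \<union> edge vs 1" "(1, 1) \<in> edge vs 0 \<union> edge vs 1" by auto
  have diag: "\<exists>i j. {i, j} = {0, 1} \<and> (0, 0) \<in> edge vs i \<and> (1, 1) \<in> edge vs i
      \<and> (0, 1) \<in> edge vs j \<and> (1, 0) \<in> edge vs j"
    using in4 row[of 0 0] row[of 0 1] row[of 1 0] row[of 1 1] col[of 0 0] col[of 0 1] col[of 1 0] col[of 1 1]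
    by auto
  then obtain i j where ij: "{i, j} = {0, 1}"
    and e: "(0, 0) \<in> edge vs i" "(1, 1) \<in> edge vs i" "(0, 1) \<in> edge vs j" "(1, 0) \<in> edge vs j" by auto
  let ?c = "vs ! 1"
  have ci: "?c \<in> edge vs i" "?c \<in> edge vs j" using ij by (auto simp: edge_def doubleton_eq_iff)
  have eq: "fst ?c = snd ?c"
    using line[OF e(1,2)] line[OF e(1) ci(1)] slanted[of i 0 0] e(1) ij
    by (auto simp: cross_def doubleton_eq_iff)
  have "snd (?d j) = - fst (?d j)" using line[OF e(3,4)] by (simp add: cross_def)
  moreover have "(fst c + snd c - 1) * fst D = 0" if "snd D = - fst D" "cross (c - (0, 1)) D = 0" for c D
    using that by (simp add: cross_def algebra_simps)
  ultimately have "(fst ?c + snd ?c - 1) * fst (?d j) = 0"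
    using line[OF e(3) ci(2)] by blast
  then have "fst ?c + snd ?c = 1"
    using slanted[of j 0 1] e(3) ij by (auto simp: doubleton_eq_iff)
  then have c: "?c = (1/2, 1/2)" using eq by (auto simp: prod_eq_iff)
  have "?c = vs ! i \<or> ?c = vs ! Suc i" using ij by (auto simp: doubleton_eq_iff)
  then obtain b where b: "edge vs i = closed_segment ?c b"
    unfolding edge_def by (metis closed_segment_commute)
  from e(1) obtain s where s: "0 \<le> s" "(1 - s) * (1/2) + s * fst b = 0"
    unfolding b in_segment c by (auto simp: prod_eq_iff)
  from e(2) obtain t where t: "0 \<le> t" "(1 - t) * (1/2) + t * fst b = 1"
    unfolding b in_segment c by (auto simp: prod_eq_iff)
  \<comment> \<open>The ends of the diagonal lie on opposite sides of \<open>?c\<close>, so their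
    parameters counted from \<open>?c\<close> cannot both be nonnegative.\<close>
  have "s * (2 * fst b - 1) = -1" using s(2) by (simp add: field_simps)
  moreover have "t * (2 * fst b - 1) = 1" using t(2) by (simp add: field_simps)
  ultimately have "s * (2 * fst b - 1) < 0" "0 < t * (2 * fst b - 1)" by simp_all
  then show False using s(1) t(1) by (simp add: mult_less_0_iff zero_less_mult_iff)
qed

text \<open>For positive \<open>n\<close> this is the minimum; that it is attained is known only
  once the chains are built. The \<open>max\<close> accounts for \<open>n = 1\<close>.\<close>

definition min_links :: "nat \<Rightarrow> nat" where
  "min_links n = (if n = 2 then 3 else max 1 (2 * n - 2))"

lemma min_links_ge_3: "3 \<le> n \<Longrightarrow> min_links n = 2 * n - 2"
  by (simp add: min_links_def)

lemma min_links_le: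
  assumes "covering_trail n vs"
  shows "min_links n \<le> link_length vs"
proof -
  have "1 \<le> link_length vs" using assms by (auto simp: covering_trail_def link_length_def)
  then show ?thesis using trail_cases[OF assms] trail_2_ge_3 assms by (auto simp: min_links_def)
qed

section \<open>Chains passing each grid point once\<close>

text \<open>Edges are taken without their end point, so that a grid point that is a vertex of the chain is
  counted for the edge leading away from it only.\<close>

locale exact_chain =
  fixes n :: nat and vs :: chain and K :: nat
  assumes len: "length vs = Suc K" and K: "0 < K"
    and turn: "\<And>i. Suc i < K \<Longrightarrow> cross (vs ! Suc i - vs ! i) (vs ! Suc (Suc i) - vs ! Suc i) \<noteq> 0"
    and distinct_ends: "\<And>i. i < K \<Longrightarrow> vs ! i \<noteq> vs ! Suc i"
    and once: "\<And>p. p \<in> grid n \<Longrightarrow> \<exists>!i. i < K \<and> p \<in> edge vs i \<and> p \<noteq> vs ! Suc i"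
    and used: "\<And>i. i < K \<Longrightarrow> \<exists>p\<in>grid n. p \<in> edge vs i \<and> p \<noteq> vs ! Suc i"
    and last_not_grid: "vs ! K \<notin> grid n"
begin

lemma link_length: "link_length vs = K"
  using len by (simp add: link_length_def)

lemma once_eq:
  assumes "p \<in> grid n" "i < K" "p \<in> edge vs i" "p \<noteq> vs ! Suc i"
    "j < K" "p \<in> edge vs j" "p \<noteq> vs ! Suc j"
  shows "i = j"
  using once[of p] assms by blast

text \<open>Apart from vertices, uniqueness is \<open>once\<close>. At a vertex two edges contain
  the point, but the end of one and the start of the next have the same parameter.\<close>

lemma card_pass_times:
  assumes p: "p \<in> grid n"
  shows "card (pass_times vs p) = 1"
proof -
  obtain i where i: "i < K" "p \<in> edge vs i" "p \<noteq> vs ! Suc i" using once[OF p] by blast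
  obtain s where s: "0 \<le> s" "s \<le> 1" "linepath (vs ! i) (vs ! Suc i) s = p"
    using i(2) unfolding edge_def linepath_image_01[symmetric] by auto
  have "pass_times vs p = {real i + s}"
  proof (intro equalityI subsetI)
    fix t assume "t \<in> pass_times vs p"
    then obtain j r where t: "t = real j + r" and j: "j < K" and r: "0 \<le> r" "r \<le> 1"
      and pr: "linepath (vs ! j) (vs ! Suc j) r = p"
      unfolding pass_times_def link_length by auto
    have pj: "p \<in> edge vs j" unfolding edge_def using r pr linepath_in_path by fastforce
    show "t \<in> {real i + s}"
    proof (cases "p = vs ! Suc j")
      case True
      have "linepath (vs ! j) (vs ! Suc j) 1 = p" using True by (simp add: linepath_def)
      then have "r = 1" using inj_on_linepath[OF distinct_ends[OF j]] pr r
        by (auto simp: inj_on_def)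
      \<comment> \<open>A grid point is not the end of the chain, so another edge leads away from
        it.\<close>
      have "Suc j \<noteq> K" using True p last_not_grid by auto
      then have j': "Suc j < K" using j by simp
      then have "p \<noteq> vs ! Suc (Suc j)" using True distinct_ends by metis
      moreover have "p \<in> edge vs (Suc j)" using True by (simp add: edge_def)
      ultimately have "i = Suc j" using once_eq[OF p i j'] by blast
      then have "linepath (vs ! i) (vs ! Suc i) 0 = p" using True by (simp add: linepath_def)
      then have "s = 0" using inj_on_linepath[OF distinct_ends[OF i(1)]] s
        by (auto simp: inj_on_def)
      then show ?thesis using t \<open>r = 1\<close> \<open>i = Suc j\<close> by simp
    next
      case False
      then have "i = j" using once_eq[OF p i j pj] by blast
      then have "s = r" using inj_on_linepath[OF distinct_ends[OF i(1)]] s pr r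
        by (auto simp: inj_on_def)
      then show ?thesis using t \<open>i = j\<close> by simp
    qed
  next
    fix t assume "t \<in> {real i + s}"
    then show "t \<in> pass_times vs p" using i s unfolding pass_times_def link_length by auto
  qed
  then show ?thesis by simp
qed

text \<open>By \<open>used\<close> each edge leads away from a grid point, and by
  \<open>once\<close> no other edge does. If two edges coincided as sets, that point of the earlier
  one would have to be the end of the later one, and the edge after that would lead away from it as
  well.\<close>

lemma inj_on_edge: "inj_on (edge vs) {..<K}"
proof -
  have False if ij: "i < j" "j < K" and eq: "edge vs i = edge vs j" for i j
  proof -
    obtain p where p: "p \<in> grid n" "p \<in> edge vs i" "p \<noteq> vs ! Suc i" using used[of i] ij by auto
    have pj: "p \<in> edge vs j" using p eq by simp
    then have at_end: "p = vs ! Suc j" using once_eq[OF p(1) _ p(2,3) ij(2)] ij by auto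
    then have "Suc j \<noteq> K" using p(1) last_not_grid by auto
    then have "Suc j < K" using ij by simp
    moreover have "p \<noteq> vs ! Suc (Suc j)" using at_end distinct_ends calculation by metis
    moreover have "p \<in> edge vs (Suc j)" using at_end by (simp add: edge_def)
    ultimately have "i = Suc j" using once_eq[OF p(1) _ p(2,3)] ij by auto
    then show False using ij by simp
  qed
  then show ?thesis unfolding inj_on_def by (metis lessThan_iff linorder_neqE_nat)
qed

lemma covering_trail: "covering_trail n vs"
proof -
  have "pass_times vs p \<noteq> {}" if "p \<in> grid n" for p
    using card_pass_times[OF that] by force
  moreover have "\<not> collinear (edge vs i \<union> edge vs (Suc i))" if "Suc i < K" for i
  proof
    assume "collinear (edge vs i \<union> edge vs (Suc i))"
    then obtain u where "\<forall>x\<in>edge vs i \<union> edge vs (Suc i). \<forall>y\<in>edge vs i \<union> edge vs (Suc i). \<exists>c. x - y = c *\<^sub>R u"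
      unfolding collinear_def by blast
    then have "\<exists>c. vs ! Suc i - vs ! i = c *\<^sub>R u" "\<exists>c. vs ! Suc (Suc i) - vs ! Suc i = c *\<^sub>R u"
      by (auto simp: edge_def)
    then show False using turn[OF that] by auto
  qed
  ultimately show ?thesis
    using len K distinct_ends inj_on_edge by (simp add: covering_trail_def link_length)
qed

lemma covering_path: "covering_path n vs"
  using covering_trail card_pass_times by (simp add: covering_path_def)

text \<open>The start is also the end, hence no grid point, so the value \<open>2\<close> in
  \<open>covering_cycle_def\<close> does not arise.\<close>

lemma covering_cycle:
  assumes "hd vs = last vs"
  shows "covering_cycle n vs"
proof -
  have "last vs = vs ! K" using len by (metis diff_Suc_1 last_conv_nth length_0_conv nat.distinct(1))
  then have "hd vs \<notin> grid n" using assms last_not_grid by simp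
  then show ?thesis
    using covering_trail card_pass_times assms by (auto simp: covering_cycle_def covering_circuit_def)
qed

end

text \<open>The direction is prescribed up to a nonzero factor, so turns can be checked on the keys
  alone and an edge may be traversed either way. Integer coordinates keep the condition on the
  points within reach of linear arithmetic.\<close>

definition lays ::
  "nat \<Rightarrow> (int \<Rightarrow> int \<Rightarrow> 'k) \<Rightarrow> ('k \<Rightarrow> real \<times> real) \<Rightarrow> real \<times> real \<Rightarrow> real \<times> real \<Rightarrow> 'k \<Rightarrow> bool" where
  "lays n \<kappa> \<delta> u v k \<longleftrightarrow>
     (\<exists>c. c \<noteq> 0 \<and> v - u = c *\<^sub>R \<delta> k) \<and>
     (\<forall>x\<in>{0..<int n}. \<forall>y\<in>{0..<int n}.
        (of_int x, of_int y) \<in> closed_segment u v \<and> (of_int x, of_int y) \<noteq> v \<longleftrightarrow> \<kappa> x y = k)"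

text \<open>The list \<open>ks\<close> names the edges of the chain with vertices \<open>u # vs\<close>, and \<open>\<kappa> x y\<close> is the name of the
  only edge that is to pass the grid point \<open>(x, y)\<close>.\<close>

fun covers :: "nat \<Rightarrow> (int \<Rightarrow> int \<Rightarrow> 'k) \<Rightarrow> ('k \<Rightarrow> real \<times> real) \<Rightarrow> real \<times> real \<Rightarrow> chain \<Rightarrow> 'k list \<Rightarrow> bool" where
  "covers n \<kappa> \<delta> u [] [] \<longleftrightarrow> True"
| "covers n \<kappa> \<delta> u (v # vs) (k # ks) \<longleftrightarrow>
     lays n \<kappa> \<delta> u v k \<and> covers n \<kappa> \<delta> v vs ks"
| "covers n \<kappa> \<delta> u _ _ \<longleftrightarrow> False"

lemma covers_length: "covers n \<kappa> \<delta> u vs ks \<Longrightarrow> length vs = length ks"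
  by (induction n \<kappa> \<delta> u vs ks rule: covers.induct) auto

lemma covers_append:
  assumes "length vs = length ks"
  shows "covers n \<kappa> \<delta> u (vs @ ws) (ks @ ls) \<longleftrightarrow>
    covers n \<kappa> \<delta> u vs ks \<and> covers n \<kappa> \<delta> (last (u # vs)) ws ls"
  using assms by (induction vs ks arbitrary: u rule: list_induct2) auto

text \<open>For the periodic part of a chain: \<open>w q\<close> is the vertex at which block
  \<open>q\<close> starts.\<close>

lemma covers_concat:
  assumes "\<And>q. q < m \<Longrightarrow> covers n \<kappa> \<delta> (w q) (vss q) (ks q) \<and> last (w q # vss q) = w (Suc q)"
  shows "covers n \<kappa> \<delta> (w 0) (concat (map vss [0..<m])) (concat (map ks [0..<m])) \<and>
    last (w 0 # concat (map vss [0..<m])) = w m"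
  using assms
proof (induction m)
  case 0
  show ?case by simp
next
  case (Suc m)
  let ?vss = "concat (map vss [0..<m])" and ?ks = "concat (map ks [0..<m])"
  have IH: "covers n \<kappa> \<delta> (w 0) ?vss ?ks" "last (w 0 # ?vss) = w m" using Suc by auto
  have new: "covers n \<kappa> \<delta> (w m) (vss m) (ks m)" "last (w m # vss m) = w (Suc m)" using Suc.prems by auto
  have "last (w 0 # ?vss @ vss m) = w (Suc m)"
    using IH(2) new(2) by (cases "vss m") auto
  then show ?case using IH new covers_append[OF covers_length[OF IH(1)]] by simp
qed

lemma covers_nth:
  assumes "covers n \<kappa> \<delta> u vs ks" "i < length ks"
  shows "lays n \<kappa> \<delta> ((u # vs) ! i) ((u # vs) ! Suc i) (ks ! i)"
  using assms
proof (induction n \<kappa> \<delta> u vs ks arbitrary: i rule: covers.induct)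
  case (2 n \<kappa> \<delta> u v vs k ks)
  show ?case
  proof (cases i)
    case 0
    then show ?thesis using 2(2) by simp
  next
    case (Suc j)
    then show ?thesis using 2(1)[of j] 2(2,3) by simp
  qed
qed auto

lemma grid_int:
  "p \<in> grid n \<longleftrightarrow> (\<exists>x\<in>{0..<int n}. \<exists>y\<in>{0..<int n}. p = (of_int x, of_int y))"
proof
  assume "p \<in> grid n"
  then obtain i j where "p = (real i, real j)" "i < n" "j < n" by (auto simp: grid_def)
  then show "\<exists>x\<in>{0..<int n}. \<exists>y\<in>{0..<int n}. p = (of_int x, of_int y)"
    by (intro bexI[of _ "int i"] bexI[of _ "int j"]) auto
next
  assume "\<exists>x\<in>{0..<int n}. \<exists>y\<in>{0..<int n}. p = (of_int x, of_int y)"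
  then obtain x y where "x \<in> {0..<int n}" "y \<in> {0..<int n}" "p = (of_int x, of_int y)" by blast
  then show "p \<in> grid n"
    unfolding grid_def by (intro CollectI exI[of _ "nat x"] exI[of _ "nat y"]) auto
qed

text \<open>Equality in the lower bound forces the keys to be pairwise distinct and all used: the edges
  of a shorter selection of keys would still cover the grid.\<close>

lemma exact_chain_covers:
  assumes cov: "covers n \<kappa> \<delta> u vs ks" and len: "length ks = 2 * n - 2" and n: "2 \<le> n"
    and turns: "successively (\<lambda>k l. cross (\<delta> k) (\<delta> l) \<noteq> 0) ks"
    and keys: "\<And>x y. x \<in> {0..<int n} \<Longrightarrow> y \<in> {0..<int n} \<Longrightarrow> \<kappa> x y \<in> set ks"
    and row: "y0 \<in> {0..<int n}" "\<And>x. x \<in> {0..<int n} \<Longrightarrow> snd (\<delta> (\<kappa> x y0)) \<noteq> 0"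
    and col: "x0 \<in> {0..<int n}" "\<And>y. y \<in> {0..<int n} \<Longrightarrow> fst (\<delta> (\<kappa> x0 y)) \<noteq> 0"
    and last: "last vs \<notin> grid n"
  shows "exact_chain n (u # vs) (2 * n - 2)"
proof -
  let ?K = "2 * n - 2" and ?vs = "u # vs"
  note nth = covers_nth[OF cov, unfolded len lays_def, folded edge_def]
  have key: "(of_int x, of_int y) \<in> edge ?vs i \<and> (of_int x, of_int y) \<noteq> ?vs ! Suc i \<longleftrightarrow> \<kappa> x y = ks ! i"
    if "i < ?K" "x \<in> {0..<int n}" "y \<in> {0..<int n}" for i x y
    by (rule bspec[OF bspec[OF conjunct2[OF nth[OF that(1)]] that(2)] that(3)])
  have lvs: "length vs = ?K" using covers_length[OF cov] len by simp
  \<comment> \<open>A zero direction would contradict the turn at one end of the edge; there is such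
    a turn because there are at least two edges.\<close>
  have nz: "\<delta> (ks ! i) \<noteq> 0" if "i < ?K" for i
  proof -
    have "length ks > 1" using len n by simp
    show ?thesis
    proof (cases "Suc i < ?K")
      case True
      then show ?thesis using turns len by (auto simp: successively_conv_nth cross_def)
    next
      case False
      then obtain j where "i = Suc j" using that n by (cases i) auto
      then show ?thesis using turns len that by (auto simp: successively_conv_nth cross_def)
    qed
  qed
  define P where "P = (\<lambda>x y. (real_of_int x, real_of_int y))"
  define used where "used = (\<lambda>(x, y). \<kappa> x y) ` ({0..<int n} \<times> {0..<int n})"
  have used_sub: "used \<subseteq> set ks" using keys by (auto simp: used_def)
  \<comment> \<open>One edge is selected for each key in use; the selected edges already contain all
    grid points.\<close>
  define sel where "sel = (\<lambda>k. SOME i. i < ?K \<and> ks ! i = k)"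
  have sel: "sel k < ?K \<and> ks ! sel k = k" if "k \<in> used" for k
    unfolding sel_def by (rule someI_ex) (use that used_sub len in \<open>auto simp: in_set_conv_nth\<close>)
  define S where "S = (\<lambda>k. {P x y | x y. x \<in> {0..<int n} \<and> y \<in> {0..<int n} \<and> \<kappa> x y = k})"
  have inS: "p \<in> edge ?vs (sel k)" if k: "k \<in> used" and p: "p \<in> S k" for k p
  proof -
    obtain x y where xy: "p = (of_int x, of_int y)" "x \<in> {0..<int n}" "y \<in> {0..<int n}" "\<kappa> x y = k"
      using p by (auto simp: S_def P_def)
    have i: "sel k < ?K" "ks ! sel k = k" using sel[OF k] by simp_all
    show ?thesis using key[OF i(1) xy(2,3)] xy(1,4) i(2) by simp
  qed
  have "2 * n \<le> card used + 2"
  proof (rule line_cover_lower_bound(1)[where S = S and d = \<delta>])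
    show "finite used" by (simp add: used_def)
    show "\<delta> k \<noteq> 0" if "k \<in> used" for k using nz[of "sel k"] sel[OF that] by simp
    show "cross (q - p) (\<delta> k) = 0" if k: "k \<in> used" and pq: "p \<in> S k" "q \<in> S k" for k p q
    proof -
      obtain c where "c \<noteq> 0" "?vs ! Suc (sel k) - ?vs ! sel k = c *\<^sub>R \<delta> k"
        using nth[of "sel k"] sel[OF k] by auto
      then show ?thesis
        using cross_closed_segment[of p "?vs ! sel k" "?vs ! Suc (sel k)" q] inS[OF k pq(1)] inS[OF k pq(2)]
        by (simp add: edge_def)
    qed
    show "grid n \<subseteq> (\<Union>k\<in>used. S k)"
    proof
      fix p assume "p \<in> grid n"
      then obtain x y where "x \<in> {0..<int n}" "y \<in> {0..<int n}" "p = P x y"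
        by (auto simp: grid_int P_def)
      then have "\<kappa> x y \<in> used" "p \<in> S (\<kappa> x y)" by (auto simp: used_def S_def)
      then show "p \<in> (\<Union>k\<in>used. S k)" by blast
    qed
    \<comment> \<open>The row \<open>y0\<close> meets no horizontal key and the column
      \<open>x0\<close> no vertical one: these are the free row and column that the bound
      requires.\<close>
    have "nat y0 \<in> free_rows n used S \<delta>"
      unfolding free_rows_def using row by (auto simp: S_def P_def)
    then show "free_rows n used S \<delta> \<noteq> {}" by blast
    have "nat x0 \<in> free_cols n used S \<delta>"
      unfolding free_cols_def using col by (auto simp: S_def P_def)
    then show "free_cols n used S \<delta> \<noteq> {}" by blast
  qed
  \<comment> \<open>The numbers \<open>length ks\<close>, \<open>card used\<close>,
    \<open>card (set ks)\<close> and again \<open>length ks\<close> form an increasing chain, so all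
    are equal.\<close>
  then have "length ks \<le> card used" using len by simp
  moreover have "card used \<le> card (set ks)" using used_sub by (simp add: card_mono)
  ultimately have dist: "distinct ks" and "card (set ks) \<le> card used"
    using card_length[of ks] by (auto intro: card_distinct)
  then have all: "used = set ks" using used_sub by (simp add: card_seteq)
  show ?thesis
  proof
    show "length ?vs = Suc ?K" using lvs by simp
    show "0 < ?K" using n by simp
    show "cross (?vs ! Suc i - ?vs ! i) (?vs ! Suc (Suc i) - ?vs ! Suc i) \<noteq> 0" if "Suc i < ?K" for i
      using nth[of i] nth[of "Suc i"] that turns len by (auto simp: successively_conv_nth)
    show "?vs ! i \<noteq> ?vs ! Suc i" if "i < ?K" for i
      using nth[OF that] nz[OF that] by auto
    show "\<exists>!i. i < ?K \<and> p \<in> edge ?vs i \<and> p \<noteq> ?vs ! Suc i" if p: "p \<in> grid n" for p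
    proof -
      obtain x y where xy: "x \<in> {0..<int n}" "y \<in> {0..<int n}" "p = (of_int x, of_int y)"
        using p by (auto simp: grid_int)
      then have "i < ?K \<and> p \<in> edge ?vs i \<and> p \<noteq> ?vs ! Suc i \<longleftrightarrow> i < ?K \<and> ks ! i = \<kappa> x y" for i
        using key[OF _ xy(1,2), of i] by auto
      moreover have "\<exists>!i. i < ?K \<and> ks ! i = \<kappa> x y"
        using distinct_Ex1[OF dist keys[OF xy(1,2)]] len by simp
      ultimately show ?thesis by simp
    qed
    show "\<exists>p\<in>grid n. p \<in> edge ?vs i \<and> p \<noteq> ?vs ! Suc i" if "i < ?K" for i
    proof -
      have "ks ! i \<in> used" using all that len by simp
      then obtain x y where xy: "x \<in> {0..<int n}" "y \<in> {0..<int n}" "\<kappa> x y = ks ! i"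
        by (auto simp: used_def)
      then have "P x y \<in> grid n" "P x y \<in> edge ?vs i \<and> P x y \<noteq> ?vs ! Suc i"
        using key[OF that xy(1,2)] by (auto simp: grid_int P_def)
      then show ?thesis by blast
    qed
    have "vs \<noteq> []" using lvs n by auto
    then have "?vs ! ?K = List.last vs" using last_conv_nth[of ?vs] lvs by simp
    then show "?vs ! ?K \<notin> grid n" using last by simp
  qed
qed

section \<open>Billiard boxes\<close>

lemma mem_closed_segment_slope:
  fixes p :: "real \<times> real"
  assumes "fst u \<noteq> fst v" and "snd v - snd u = s * (fst v - fst u)"
  shows "p \<in> closed_segment u v \<longleftrightarrow> snd p - snd u = s * (fst p - fst u) \<and>
    min (fst u) (fst v) \<le> fst p \<and> fst p \<le> max (fst u) (fst v)"
proof
  assume "p \<in> closed_segment u v"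
  then obtain t where t: "0 \<le> t" "t \<le> 1" "p - u = t *\<^sub>R (v - u)" by (rule closed_segmentE)
  have f: "fst p = fst u + t * (fst v - fst u)" and g: "snd p - snd u = t * (snd v - snd u)"
    using arg_cong[OF t(3), of fst] arg_cong[OF t(3), of snd] by simp_all
  have "fst p \<in> closed_segment (fst u) (fst v)"
    unfolding in_segment using t f by (auto simp: algebra_simps intro!: exI[of _ t])
  then show "snd p - snd u = s * (fst p - fst u) \<and> min (fst u) (fst v) \<le> fst p \<and> fst p \<le> max (fst u) (fst v)"
    using f g assms(2) by (auto simp: closed_segment_eq_real_ivl split: if_splits)
next
  assume R: "snd p - snd u = s * (fst p - fst u) \<and> min (fst u) (fst v) \<le> fst p \<and> fst p \<le> max (fst u) (fst v)"
  then have "fst p \<in> closed_segment (fst u) (fst v)"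
    by (auto simp: closed_segment_eq_real_ivl min_def max_def split: if_splits)
  then obtain t where t: "0 \<le> t" "t \<le> 1" "fst p = (1 - t) * fst u + t * fst v"
    by (auto simp: in_segment)
  have d: "fst p - fst u = t * (fst v - fst u)" using t(3) by (simp add: algebra_simps)
  have "snd p - snd u = t * (snd v - snd u)" using R assms(2) unfolding d by simp
  then have "p = (1 - t) *\<^sub>R u + t *\<^sub>R v"
    using t(3) by (simp add: prod_eq_iff algebra_simps)
  then show "p \<in> closed_segment u v" using t(1,2) by (auto simp: in_segment)
qed

lemma mem_closed_segment_vertical:
  "(x, y) \<in> closed_segment (c, a) (c, b) \<longleftrightarrow> x = (c::real) \<and> y \<in> closed_segment a (b::real)"
  by (auto simp: in_segment algebra_simps)

text \<open>In the columns \<open>L, \<dots>, L + b - 1\<close> the name of a point is the line of slope \<open>1\<close> or \<open>- 1\<close> through it,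
  \<open>Rise i\<close> for \<open>x - L - y = 2 * i\<close> and \<open>Fall i\<close> for \<open>x - L + y + 1 = 2 * i\<close>; by parity exactly one of the
  two exists. In the other columns it is the vertical line. For odd \<open>n\<close> the partial function \<open>sp\<close> makes
  exceptions for the points on two lines \<open>Steep\<close> of other slopes.\<close>

datatype key = Rise int | Fall int | Vert int | Steep bool

definition dir :: "real \<Rightarrow> real \<Rightarrow> key \<Rightarrow> real \<times> real" where
  "dir s t k = (case k of Rise _ \<Rightarrow> (1, 1) | Fall _ \<Rightarrow> (1, -1) | Vert _ \<Rightarrow> (0, 1) | Steep m \<Rightarrow> (1, if m then s else t))"

text \<open>Doubled coordinates, since the reflections take place halfway between two columns.\<close>

definition pt :: "int \<Rightarrow> int \<Rightarrow> real \<times> real" where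
  "pt X Y = (of_int X / 2, of_int Y / 2)"

lemma int_half_simps:
  "of_int x = (of_int X / 2 :: real) \<longleftrightarrow> 2 * x = X"
  "of_int X / 2 \<le> (of_int x :: real) \<longleftrightarrow> X \<le> 2 * x"
  "(of_int x :: real) \<le> of_int X / 2 \<longleftrightarrow> 2 * x \<le> X"
  "of_int X / 2 < (of_int x :: real) \<longleftrightarrow> X < 2 * x"
  "(of_int x :: real) < of_int X / 2 \<longleftrightarrow> 2 * x < X"
  by linarith+

lemma lays_slope:
  assumes "fst u \<noteq> fst v" and "snd v - snd u = s * (fst v - fst u)" and "\<delta> k = (1, s)"
    and "\<And>x y. x \<in> {0..<int n} \<Longrightarrow> y \<in> {0..<int n} \<Longrightarrow>
      of_int y - snd u = s * (of_int x - fst u) \<and> min (fst u) (fst v) \<le> of_int x \<and>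
      of_int x \<le> max (fst u) (fst v) \<and> of_int x \<noteq> fst v \<longleftrightarrow> \<kappa> x y = k"
  shows "lays n \<kappa> \<delta> u v k"
  unfolding lays_def
proof (intro conjI ballI)
  have "v - u = (fst v - fst u) *\<^sub>R \<delta> k"
    using assms(2,3) by (simp add: prod_eq_iff algebra_simps)
  then show "\<exists>c. c \<noteq> 0 \<and> v - u = c *\<^sub>R \<delta> k" using assms(1) by (intro exI[of _ "fst v - fst u"]) simp
next
  fix x y assume xy: "x \<in> {0..<int n}" "y \<in> {0..<int n}"
  let ?p = "(real_of_int x, real_of_int y)"
  have "?p \<in> closed_segment u v \<and> ?p \<noteq> v \<longleftrightarrow> ?p \<in> closed_segment u v \<and> fst ?p \<noteq> fst v"
    unfolding mem_closed_segment_slope[OF assms(1,2)] using assms(2)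
    by (auto simp: prod_eq_iff algebra_simps)
  then show "?p \<in> closed_segment u v \<and> ?p \<noteq> v \<longleftrightarrow> \<kappa> x y = k"
    unfolding mem_closed_segment_slope[OF assms(1,2)] using assms(4)[OF xy] by auto
qed

text \<open>\<open>L\<close> is the first column of the box and \<open>b\<close> the number of its
  columns. An exception may be a \<open>Fall\<close> key outside the box, provided that the point
  lies on that line; this lets a chain turn at a grid point beside the box.\<close>

locale box =
  fixes n :: nat and L b :: int and sp :: "int \<Rightarrow> int \<Rightarrow> key option" and s t :: real
  assumes n_pos: "0 < n"
    and sp_rise: "sp x y \<noteq> Some (Rise i)" and sp_vert: "sp x y \<noteq> Some (Vert i)"
    and sp_fall: "sp x y = Some (Fall i) \<Longrightarrow> x - L + y + 1 = 2 * i"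
begin

definition \<kappa> :: "int \<Rightarrow> int \<Rightarrow> key" where
  "\<kappa> x y = (case sp x y of Some k \<Rightarrow> k | None \<Rightarrow>
     if x < L \<or> L + b \<le> x then Vert x
     else if even (x - L - y) then Rise ((x - L - y) div 2) else Fall ((x - L + y + 1) div 2))"

lemma \<kappa>_rise: "\<kappa> x y = Rise i \<longleftrightarrow> sp x y = None \<and> L \<le> x \<and> x < L + b \<and> x - L - y = 2 * i"
proof -
  have "(if even d then Rise (d div 2) else Fall e) = Rise i \<longleftrightarrow> d = 2 * i" for d e :: int by auto
  then show ?thesis using sp_rise by (auto simp: \<kappa>_def simp del: even_diff split: option.splits)
qed

lemma \<kappa>_fall: "\<kappa> x y = Fall i \<longleftrightarrow> sp x y = Some (Fall i) \<or>
    sp x y = None \<and> L \<le> x \<and> x < L + b \<and> x - L + y + 1 = 2 * i"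
proof -
  have "(if even d then Rise e else Fall ((d + 2 * y + 1) div 2)) = Fall i \<longleftrightarrow> d + 2 * y + 1 = 2 * i" for d e :: int
    by (cases "even d") (simp, presburger)+
  moreover have "x - L - y + 2 * y + 1 = x - L + y + 1" by simp
  ultimately have
    "(if even (x - L - y) then Rise e else Fall ((x - L + y + 1) div 2)) = Fall i \<longleftrightarrow> x - L + y + 1 = 2 * i" for e
    by metis
  then show ?thesis by (cases "sp x y") (auto simp: \<kappa>_def simp del: even_diff)
qed

lemma \<kappa>_vert: "\<kappa> x y = Vert c \<longleftrightarrow> sp x y = None \<and> (x < L \<or> L + b \<le> x) \<and> x = c"
  using sp_vert by (auto simp: \<kappa>_def split: option.splits)

abbreviation lay where "lay \<equiv> lays n \<kappa> (dir s t)"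

text \<open>In doubled coordinates, \<open>x - L - y = 2 * i\<close> reads
  \<open>X - Y = 2 * L + 4 * i\<close>. The last assumption is kept general for edges with an end at
  a grid point.\<close>

lemma lay_rise_raw:
  assumes "X1 - Y1 = 2 * L + 4 * i" "X2 - Y2 = 2 * L + 4 * i" "X1 \<noteq> X2"
    and "\<And>x y. x \<in> {0..<int n} \<Longrightarrow> y \<in> {0..<int n} \<Longrightarrow> x - y = L + 2 * i \<Longrightarrow>
      min X1 X2 \<le> 2 * x \<and> 2 * x \<le> max X1 X2 \<and> 2 * x \<noteq> X2 \<longleftrightarrow> sp x y = None \<and> L \<le> x \<and> x < L + b"
  shows "lay (pt X1 Y1) (pt X2 Y2) (Rise i)"
proof (rule lays_slope[where s = 1])
  fix x y assume xy: "x \<in> {0..<int n}" "y \<in> {0..<int n}"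
  have "of_int y - real_of_int Y1 / 2 = of_int x - of_int X1 / 2 \<longleftrightarrow> x - y = L + 2 * i"
  proof -
    have "of_int y - real_of_int Y1 / 2 = of_int x - of_int X1 / 2 \<longleftrightarrow>
        real_of_int (X1 - Y1) = real_of_int (2 * (x - y))" by (simp add: field_simps) linarith
    also have "\<dots> \<longleftrightarrow> 2 * L + 4 * i = 2 * (x - y)" unfolding assms(1) of_int_eq_iff ..
    finally show ?thesis by presburger
  qed
  moreover have "min (real_of_int X1 / 2) (of_int X2 / 2) = of_int (min X1 X2) / 2"
    "max (real_of_int X1 / 2) (of_int X2 / 2) = of_int (max X1 X2) / 2" by (auto simp: min_def max_def)
  ultimately show "of_int y - snd (pt X1 Y1) = 1 * (of_int x - fst (pt X1 Y1)) \<and>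
      min (fst (pt X1 Y1)) (fst (pt X2 Y2)) \<le> of_int x \<and>
      of_int x \<le> max (fst (pt X1 Y1)) (fst (pt X2 Y2)) \<and> of_int x \<noteq> fst (pt X2 Y2) \<longleftrightarrow> \<kappa> x y = Rise i"
    using assms(4)[OF xy] by (auto simp: pt_def \<kappa>_rise int_half_simps)
next
  have "real_of_int X1 - real_of_int Y1 = real_of_int X2 - real_of_int Y2"
    using assms(1,2) by (metis of_int_diff)
  then show "snd (pt X2 Y2) - snd (pt X1 Y1) = 1 * (fst (pt X2 Y2) - fst (pt X1 Y1))"
    by (simp add: pt_def field_simps)
qed (use assms(3) in \<open>simp_all add: pt_def dir_def\<close>)

lemma lay_fall_raw:
  assumes "X1 + Y1 = 2 * L + 4 * i - 2" "X2 + Y2 = 2 * L + 4 * i - 2" "X1 \<noteq> X2"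
    and "\<And>x y. x \<in> {0..<int n} \<Longrightarrow> y \<in> {0..<int n} \<Longrightarrow> x + y = L + 2 * i - 1 \<Longrightarrow>
      min X1 X2 \<le> 2 * x \<and> 2 * x \<le> max X1 X2 \<and> 2 * x \<noteq> X2 \<longleftrightarrow>
        sp x y = Some (Fall i) \<or> sp x y = None \<and> L \<le> x \<and> x < L + b"
  shows "lay (pt X1 Y1) (pt X2 Y2) (Fall i)"
proof (rule lays_slope[where s = "- 1"])
  fix x y assume xy: "x \<in> {0..<int n}" "y \<in> {0..<int n}"
  have "of_int y - real_of_int Y1 / 2 = - 1 * (of_int x - of_int X1 / 2) \<longleftrightarrow> x + y = L + 2 * i - 1"
  proof -
    have "of_int y - real_of_int Y1 / 2 = - 1 * (of_int x - of_int X1 / 2) \<longleftrightarrow>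
        real_of_int (X1 + Y1) = real_of_int (2 * (x + y))" by (simp add: field_simps) linarith
    also have "\<dots> \<longleftrightarrow> 2 * L + 4 * i - 2 = 2 * (x + y)" unfolding assms(1) of_int_eq_iff ..
    finally show ?thesis by presburger
  qed
  note line = this
  have minmax: "min (real_of_int X1 / 2) (of_int X2 / 2) = of_int (min X1 X2) / 2"
    "max (real_of_int X1 / 2) (of_int X2 / 2) = of_int (max X1 X2) / 2" by (auto simp: min_def max_def)
  have kF: "\<kappa> x y = Fall i \<longleftrightarrow> x + y = L + 2 * i - 1 \<and>
      (sp x y = Some (Fall i) \<or> sp x y = None \<and> L \<le> x \<and> x < L + b)"
    using sp_fall[of x y i] by (auto simp: \<kappa>_fall)
  show "of_int y - snd (pt X1 Y1) = - 1 * (of_int x - fst (pt X1 Y1)) \<and>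
      min (fst (pt X1 Y1)) (fst (pt X2 Y2)) \<le> of_int x \<and>
      of_int x \<le> max (fst (pt X1 Y1)) (fst (pt X2 Y2)) \<and> of_int x \<noteq> fst (pt X2 Y2) \<longleftrightarrow> \<kappa> x y = Fall i"
    unfolding pt_def fst_conv snd_conv line minmax kF int_half_simps using assms(4)[OF xy] by blast
next
  have "real_of_int X1 + real_of_int Y1 = real_of_int X2 + real_of_int Y2"
    using assms(1,2) by (metis of_int_add)
  then show "snd (pt X2 Y2) - snd (pt X1 Y1) = - 1 * (fst (pt X2 Y2) - fst (pt X1 Y1))"
    by (simp add: pt_def field_simps)
qed (use assms(3) in \<open>simp_all add: pt_def dir_def\<close>)

lemma lay_vert:
  assumes "c < L \<or> L + b \<le> c" and "y1 \<noteq> y2"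
    and "\<And>y. y \<in> {0..<int n} \<Longrightarrow> 0 \<le> c \<Longrightarrow>
      min y1 y2 \<le> of_int y \<and> of_int y \<le> max y1 y2 \<and> of_int y \<noteq> y2 \<longleftrightarrow> sp c y = None"
  shows "lay (of_int c, y1) (of_int c, y2) (Vert c)"
  unfolding lays_def
proof (intro conjI ballI)
  have "(of_int c, y2) - (of_int c, y1) = (y2 - y1) *\<^sub>R dir s t (Vert c)" by (simp add: dir_def)
  then show "\<exists>d. d \<noteq> 0 \<and> (of_int c, y2) - (of_int c, y1) = d *\<^sub>R dir s t (Vert c)"
    using assms(2) by (intro exI[of _ "y2 - y1"]) simp
next
  fix x y assume "x \<in> {0..<int n}" "y \<in> {0..<int n}"
  then show "(real_of_int x, real_of_int y) \<in> closed_segment (of_int c, y1) (of_int c, y2) \<and>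
      (real_of_int x, real_of_int y) \<noteq> (of_int c, y2) \<longleftrightarrow> \<kappa> x y = Vert c"
    using assms(3)[of y] assms(1)
    by (auto simp: \<kappa>_vert mem_closed_segment_vertical closed_segment_eq_real_ivl min_def max_def split: if_splits)
qed

lemma lay_vert_full:
  assumes "c < L \<or> L + b \<le> c"
    and "y1 < 0 \<and> real n - 1 < y2 \<or> y2 < 0 \<and> real n - 1 < y1"
    and "\<And>y. y \<in> {0..<int n} \<Longrightarrow> sp c y = None"
  shows "lay (of_int c, y1) (of_int c, y2) (Vert c)"
proof (rule lay_vert)
  show "min y1 y2 \<le> of_int y \<and> of_int y \<le> max y1 y2 \<and> of_int y \<noteq> y2 \<longleftrightarrow> sp c y = None"
    if "y \<in> {0..<int n}" for y
  proof -
    have "0 \<le> real_of_int y" "real_of_int y \<le> real n - 1" using that by auto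
    then show ?thesis using assms(2,3) that by (auto simp: min_def max_def)
  qed
  show "y1 \<noteq> y2" using assms(2) n_pos by auto
qed (use assms(1) in simp)

definition free_rise where "free_rise i \<longleftrightarrow> (\<forall>x y. x - y = L + 2 * i \<longrightarrow> sp x y = None)"
definition free_fall where "free_fall i \<longleftrightarrow> (\<forall>x y. x + y = L + 2 * i - 1 \<longrightarrow> sp x y = None)"
definition free_vert where "free_vert c \<longleftrightarrow> (\<forall>y. sp c y = None)"

text \<open>Each end of the edge either reaches the side of the box or leaves the grid at the top or bottom
  before it meets another column.\<close>

lemma lay_rise:
  assumes "X1 - Y1 = 2 * L + 4 * i" "X2 - Y2 = 2 * L + 4 * i" "X1 \<noteq> X2" "free_rise i"
    and "min X1 X2 \<le> 2 * L - 1 \<or> min X1 X2 < 2 * L + 4 * i"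
    and "2 * L - 1 \<le> min X1 X2 \<or> 0 \<le> i"
    and "2 * L + 2 * b - 1 \<le> max X1 X2 \<or> 2 * (int n - 1 + L + 2 * i) < max X1 X2"
    and "max X1 X2 \<le> 2 * L + 2 * b - 1 \<or> int n - 1 + 2 * i < b"
  shows "lay (pt X1 Y1) (pt X2 Y2) (Rise i)"
proof (rule lay_rise_raw[OF assms(1-3)])
  \<comment> \<open>The line meets row \<open>0\<close> in column \<open>L + 2 * i\<close> and the
    top row in column \<open>int n - 1 + L + 2 * i\<close>. The thresholds in the assumptions are
    these columns, doubled or compared with the sides of the box.\<close>
  fix x y assume "x \<in> {0..<int n}" "y \<in> {0..<int n}" and xy: "x - y = L + 2 * i"
  moreover have "sp x y = None" using assms(4) xy by (simp add: free_rise_def)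
  moreover have "2 * x \<noteq> X2" if "min X1 X2 < 2 * x" "2 * x < max X1 X2"
    using that by auto
  ultimately show "min X1 X2 \<le> 2 * x \<and> 2 * x \<le> max X1 X2 \<and> 2 * x \<noteq> X2 \<longleftrightarrow>
      sp x y = None \<and> L \<le> x \<and> x < L + b"
    using assms(5-8) by (smt (verit) atLeastLessThan_iff)
qed

lemma lay_fall:
  assumes "X1 + Y1 = 2 * L + 4 * i - 2" "X2 + Y2 = 2 * L + 4 * i - 2" "X1 \<noteq> X2" "free_fall i"
    and "min X1 X2 \<le> 2 * L - 1 \<or> min X1 X2 < 2 * (L + 2 * i - int n)"
    and "2 * L - 1 \<le> min X1 X2 \<or> int n \<le> 2 * i"
    and "2 * L + 2 * b - 1 \<le> max X1 X2 \<or> 2 * (L - 1 + 2 * i) < max X1 X2"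
    and "max X1 X2 \<le> 2 * L + 2 * b - 1 \<or> 2 * i \<le> b"
  shows "lay (pt X1 Y1) (pt X2 Y2) (Fall i)"
proof (rule lay_fall_raw[OF assms(1-3)])
  \<comment> \<open>Here row \<open>0\<close> is met in column \<open>L + 2 * i - 1\<close> and the
    top row in column \<open>L + 2 * i - int n\<close>.\<close>
  fix x y assume "x \<in> {0..<int n}" "y \<in> {0..<int n}" and xy: "x + y = L + 2 * i - 1"
  moreover have "sp x y = None" using assms(4) xy by (simp add: free_fall_def)
  moreover have "2 * x \<noteq> X2" if "min X1 X2 < 2 * x" "2 * x < max X1 X2"
    using that by auto
  ultimately show "min X1 X2 \<le> 2 * x \<and> 2 * x \<le> max X1 X2 \<and> 2 * x \<noteq> X2 \<longleftrightarrow>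
      sp x y = Some (Fall i) \<or> sp x y = None \<and> L \<le> x \<and> x < L + b"
    using assms(5-8) by (smt (verit) atLeastLessThan_iff option.distinct(1))
qed

lemma lay_vert_pt:
  assumes "c < L \<or> L + b \<le> c" and "free_vert c"
    and "Y1 < 0 \<and> 2 * (int n - 1) < Y2 \<or> Y2 < 0 \<and> 2 * (int n - 1) < Y1" and "X = 2 * c"
  shows "lay (pt X Y1) (pt X Y2) (Vert c)"
proof -
  have "lay (of_int c, of_int Y1 / 2) (of_int c, of_int Y2 / 2) (Vert c)"
  proof (rule lay_vert_full)
    have "real n - 1 < of_int Y / 2" if "2 * (int n - 1) < Y" for Y
    proof -
      have "real_of_int (2 * (int n - 1)) < of_int Y" using that by (simp only: of_int_less_iff)
      then show ?thesis by simp
    qed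
    then show "real_of_int Y1 / 2 < 0 \<and> real n - 1 < of_int Y2 / 2 \<or>
        real_of_int Y2 / 2 < 0 \<and> real n - 1 < of_int Y1 / 2"
      using assms(3) by auto
  qed (use assms(1,2) in \<open>auto simp: free_vert_def\<close>)
  then show ?thesis using assms(4) by (simp add: pt_def)
qed

end

section \<open>The periodic part of the chains\<close>

lemma successively_concat:
  assumes "successively P pre" "successively P suf" "pre \<noteq> []" "suf \<noteq> []" "P (last pre) (hd suf)"
    and "\<And>q. successively P (ks q) \<and> ks q \<noteq> [] \<and> P (last pre) (hd (ks q)) \<and> P (last (ks q)) (hd suf)"
    and "\<And>q r. P (last (ks q)) (hd (ks r))"
  shows "successively P (pre @ concat (map ks qs) @ suf)"
  using assms
proof (induction qs arbitrary: pre)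
  case Nil
  then show ?case by (simp add: successively_append_iff)
next
  case (Cons q qs)
  have "successively P ((pre @ ks q) @ concat (map ks qs) @ suf)"
    using Cons.prems by (intro Cons.IH) (auto simp: successively_append_iff)
  then show ?case by simp
qed

text \<open>Two trajectories through the box, each with two reflections at its sides, and the two vertical
  lines \<open>cl\<close> and \<open>cr\<close> that lead from the top exit of one to the bottom entrance of the next.\<close>

definition blk :: "int \<Rightarrow> int \<Rightarrow> int \<Rightarrow> int \<Rightarrow> int \<Rightarrow> chain" where
  "blk L k q cl cr =
    [pt (2 * L + 4 * k - 1) (4 * k + 4 * q - 1), pt (2 * cl) (2 * (4 * k + 2 * q - 1 - cl + L)),
     pt (2 * cl) (2 * (cl - L - 2 * q - 2)), pt (2 * L + 4 * k - 1) (4 * k - 4 * q - 5),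
     pt (2 * L - 1) (8 * k - 4 * q - 5), pt (2 * cr) (2 * (cr - L - 2 * q - 2 + 4 * k)),
     pt (2 * cr) (2 * (2 * q + 1 - cr + L)), pt (2 * L - 1) (4 * q + 3)]"

definition blk_keys :: "int \<Rightarrow> int \<Rightarrow> int \<Rightarrow> int \<Rightarrow> key list" where
  "blk_keys k q cl cr =
    [Rise (- q), Fall (2 * k + q), Vert cl, Rise (q + 1), Fall (2 * k - q - 1), Rise (q + 1 - 2 * k), Vert cr, Fall (q + 1)]"

text \<open>From block to block the vertical lines move on by one column on either side, and block
  \<open>q\<close> ends at the reflection point where block \<open>q + 1\<close> starts.\<close>

definition body :: "int \<Rightarrow> int \<Rightarrow> int \<Rightarrow> nat \<Rightarrow> int \<Rightarrow> int \<Rightarrow> chain" where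
  "body L k q0 m a c = concat (map (\<lambda>j. blk L k (q0 + int j) (a + q0 + int j) (c + q0 + int j)) [0..<m])"

definition body_keys :: "int \<Rightarrow> int \<Rightarrow> nat \<Rightarrow> int \<Rightarrow> int \<Rightarrow> key list" where
  "body_keys k q0 m a c = concat (map (\<lambda>j. blk_keys k (q0 + int j) (a + q0 + int j) (c + q0 + int j)) [0..<m])"

lemma length_body_keys [simp]: "length (body_keys k q0 m a c) = 8 * m"
  by (simp add: body_keys_def blk_keys_def length_concat comp_def sum_list_triv)

text \<open>With the next three lemmas, this serves to find the key of a given grid point; the
  alternatives there invert the index functions in \<open>blk_keys\<close>.\<close>

lemma mem_body_keys:
  assumes "q0 \<le> q" "q < q0 + int m" "\<xi> \<in> set (blk_keys k q (a + q) (c + q))"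
  shows "\<xi> \<in> set (body_keys k q0 m a c)"
proof -
  have "nat (q - q0) \<in> set [0..<m]" "q0 + int (nat (q - q0)) = q" using assms(1,2) by auto
  then show ?thesis using assms(3) by (auto simp: body_keys_def add.assoc intro!: bexI[of _ "nat (q - q0)"])
qed

lemma rise_mem_body_keys:
  assumes "q0 \<le> - i \<and> - i < q0 + int m \<or> q0 \<le> i - 1 \<and> i - 1 < q0 + int m
    \<or> q0 \<le> i - 1 + 2 * k \<and> i - 1 + 2 * k < q0 + int m"
  shows "Rise i \<in> set (body_keys k q0 m a c)"
  using assms mem_body_keys[of q0 "- i" m "Rise i" k a c] mem_body_keys[of q0 "i - 1" m "Rise i" k a c]
    mem_body_keys[of q0 "i - 1 + 2 * k" m "Rise i" k a c]
  by (elim disjE) (simp_all add: blk_keys_def)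

lemma fall_mem_body_keys:
  assumes "q0 \<le> i - 1 \<and> i - 1 < q0 + int m \<or> q0 \<le> 2 * k - 1 - i \<and> 2 * k - 1 - i < q0 + int m
    \<or> q0 \<le> i - 2 * k \<and> i - 2 * k < q0 + int m"
  shows "Fall i \<in> set (body_keys k q0 m a c)"
  using assms mem_body_keys[of q0 "i - 1" m "Fall i" k a c] mem_body_keys[of q0 "2 * k - 1 - i" m "Fall i" k a c]
    mem_body_keys[of q0 "i - 2 * k" m "Fall i" k a c]
  by (elim disjE) (simp_all add: blk_keys_def)

lemma vert_mem_body_keys:
  assumes "q0 \<le> x - a \<and> x - a < q0 + int m \<or> q0 \<le> x - c \<and> x - c < q0 + int m"
  shows "Vert x \<in> set (body_keys k q0 m a c)"
  using assms mem_body_keys[of q0 "x - a" m "Vert x" k a c] mem_body_keys[of q0 "x - c" m "Vert x" k a c]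
  by (elim disjE) (simp_all add: blk_keys_def)

text \<open>These pairs turn for all slopes \<open>s\<close> and \<open>t\<close>; a
  \<open>Rise\<close> next to a \<open>Steep\<close> needs a slope other than
  \<open>1\<close>.\<close>

lemma cross_dir_simps:
  "cross (dir s t (Rise i)) (dir s t (Fall j)) \<noteq> 0" "cross (dir s t (Fall i)) (dir s t (Rise j)) \<noteq> 0"
  "cross (dir s t (Rise i)) (dir s t (Vert j)) \<noteq> 0" "cross (dir s t (Vert i)) (dir s t (Rise j)) \<noteq> 0"
  "cross (dir s t (Fall i)) (dir s t (Vert j)) \<noteq> 0" "cross (dir s t (Vert i)) (dir s t (Fall j)) \<noteq> 0"
  "cross (dir s t (Steep m)) (dir s t (Vert j)) \<noteq> 0" "cross (dir s t (Vert i)) (dir s t (Steep m)) \<noteq> 0"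
  by (auto simp: cross_def dir_def)

lemma successively_body:
  fixes s t :: real
  defines "P \<equiv> \<lambda>k l. cross (dir s t k) (dir s t l) \<noteq> 0"
  assumes "successively P pre" "successively P suf" "pre \<noteq> []" "suf \<noteq> []" "P (last pre) (hd suf)"
    and "\<And>i. P (last pre) (Rise i)" "\<And>i. P (Fall i) (hd suf)"
  shows "successively P (pre @ body_keys k q0 m a c @ suf)"
  unfolding body_keys_def
  by (rule successively_concat; (fact assms)?) (use assms(7,8) in \<open>simp_all add: blk_keys_def P_def cross_dir_simps\<close>)

context box begin

lemma \<kappa>_cases:
  obtains (sp) k where "sp x y = Some k" "\<kappa> x y = k"
  | (Vert) "sp x y = None" "\<kappa> x y = Vert x" "x < L \<or> L + b \<le> x"
  | (Rise) i where "sp x y = None" "\<kappa> x y = Rise i" "L \<le> x" "x < L + b" "x - L - y = 2 * i"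
  | (Fall) i where "sp x y = None" "\<kappa> x y = Fall i" "L \<le> x" "x < L + b" "x - L + y + 1 = 2 * i"
proof (cases "sp x y")
  case None
  show ?thesis
  proof (cases "x < L \<or> L + b \<le> x")
    case True
    then show ?thesis using None by (intro Vert) (auto simp: \<kappa>_def)
  next
    case False
    show ?thesis
    proof (cases "\<exists>i. x - L - y = 2 * i")
      case True
      then obtain i where "x - L - y = 2 * i" by blast
      then show ?thesis using None False by (intro Rise[of i]) (auto simp: \<kappa>_rise)
    next
      case odd: False
      then have "\<exists>i. x - L + y + 1 = 2 * i" by presburger
      then obtain i where "x - L + y + 1 = 2 * i" ..
      then show ?thesis using None False by (intro Fall[of i]) (auto simp: \<kappa>_fall)
    qed
  qed
next
  case (Some k)
  then show ?thesis by (intro sp[of k]) (simp_all add: \<kappa>_def)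
qed

text \<open>The vertices of \<open>blk\<close> do not depend on \<open>n\<close>, so one block
  serves the side lengths \<open>4 * k - 1\<close>, \<open>4 * k\<close> and
  \<open>4 * k + 1\<close>. By \<open>1 \<le> q\<close> the second edge leaves the grid at the top
  before it meets another column, even for the largest of them.\<close>

lemma covers_blk:
  assumes "b = 2 * k" "4 * k - 1 \<le> int n" "int n \<le> 4 * k + 1" "1 \<le> q" "q \<le> k - 2"
    and "cl < L" "L + 2 * k \<le> cr"
    and "free_rise (- q)" "free_fall (2 * k + q)" "free_vert cl" "free_rise (q + 1)"
      "free_fall (2 * k - q - 1)" "free_rise (q + 1 - 2 * k)" "free_vert cr" "free_fall (q + 1)"
  shows "covers n \<kappa> (dir s t) (pt (2 * L - 1) (4 * q - 1)) (blk L k q cl cr) (blk_keys k q cl cr)"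
  unfolding blk_def blk_keys_def covers.simps
  by (intro conjI TrueI; (rule lay_rise | rule lay_fall | rule lay_vert_pt);
      use assms in \<open>simp add: min_def max_def\<close>)

lemma covers_body:
  assumes "b = 2 * k" "4 * k - 1 \<le> int n" "int n \<le> 4 * k + 1"
    and "\<And>q. q0 \<le> q \<Longrightarrow> q < q0 + int m \<Longrightarrow> 1 \<le> q \<and> q \<le> k - 2 \<and> a + q < L \<and> L + 2 * k \<le> c + q \<and>
      free_rise (- q) \<and> free_fall (2 * k + q) \<and> free_vert (a + q) \<and> free_rise (q + 1) \<and>
      free_fall (2 * k - q - 1) \<and> free_rise (q + 1 - 2 * k) \<and> free_vert (c + q) \<and> free_fall (q + 1)"
  shows "covers n \<kappa> (dir s t) (pt (2 * L - 1) (4 * q0 - 1)) (body L k q0 m a c) (body_keys k q0 m a c)"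
    and "last (pt (2 * L - 1) (4 * q0 - 1) # body L k q0 m a c) = pt (2 * L - 1) (4 * (q0 + int m) - 1)"
proof -
  define w where "w = (\<lambda>j. pt (2 * L - 1) (4 * (q0 + int j) - 1))"
  have "covers n \<kappa> (dir s t) (w 0) (body L k q0 m a c) (body_keys k q0 m a c) \<and>
    last (w 0 # body L k q0 m a c) = w m"
    unfolding body_def body_keys_def
  proof (rule covers_concat, rule conjI)
    fix j assume "j < m"
    then have j: "q0 \<le> q0 + int j" "q0 + int j < q0 + int m" by auto
    note h = assms(4)[OF j]
    show "covers n \<kappa> (dir s t) (w j) (blk L k (q0 + int j) (a + q0 + int j) (c + q0 + int j))
      (blk_keys k (q0 + int j) (a + q0 + int j) (c + q0 + int j))"
      unfolding w_def
      by (rule covers_blk) (use assms(1-3) h in \<open>simp_all add: add.assoc\<close>)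
    show "last (w j # blk L k (q0 + int j) (a + q0 + int j) (c + q0 + int j)) = w (Suc j)"
      by (simp add: w_def blk_def algebra_simps)
  qed
  then show "covers n \<kappa> (dir s t) (pt (2 * L - 1) (4 * q0 - 1)) (body L k q0 m a c) (body_keys k q0 m a c)"
    and "last (pt (2 * L - 1) (4 * q0 - 1) # body L k q0 m a c) = pt (2 * L - 1) (4 * (q0 + int m) - 1)"
    by (simp_all add: w_def)
qed

end

lemma covers_sandwich:
  assumes "covers n \<kappa> \<delta> u pre pks" "last (u # pre) = v" "covers n \<kappa> \<delta> v mid mks"
    "last (v # mid) = w" "covers n \<kappa> \<delta> w suf sks" 
  shows "covers n \<kappa> \<delta> u (pre @ mid @ suf) (pks @ mks @ sks)"
  using assms by (simp add: covers_append covers_length)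

lemma pt_grid: "pt X Y \<in> grid n \<longleftrightarrow> (\<exists>x y. X = 2 * x \<and> Y = 2 * y \<and> 0 \<le> x \<and> x < int n \<and> 0 \<le> y \<and> y < int n)"
proof -
  have "pt X Y = (of_int x, of_int y) \<longleftrightarrow> X = 2 * x \<and> Y = 2 * y" for x y
    unfolding pt_def prod.inject using int_half_simps(1)[of x X] int_half_simps(1)[of y Y] by auto
  then show ?thesis by (auto simp: grid_int)
qed

section \<open>Even side length\<close>

text \<open>The box occupies the columns from \<open>K\<close> to \<open>3 * K - 1\<close>. The
  periodic part uses up all other columns except \<open>0\<close>, \<open>K - 1\<close>,
  \<open>3 * K\<close> and \<open>4 * K - 1\<close>, which serve to close the chain.\<close>

lemma cycle_4k:
  assumes k: "2 \<le> k"
  shows "\<exists>vs. exact_chain (4 * k) vs (2 * (4 * k) - 2) \<and> hd vs = last vs"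
proof -
  define K where "K = int k"
  have K: "2 \<le> K" "int (4 * k) = 4 * K" "int (k - 2) = K - 2" using k by (auto simp: K_def)
  interpret box "4 * k" K "2 * K" "\<lambda>_ _. None" 0 0
    using k by unfold_locales auto
  have fr: "free_rise i" "free_fall i" "free_vert i" for i by (simp_all add: free_rise_def free_fall_def free_vert_def)
  define u where "u = pt (2 * (K - 1)) (- 2)"
  \<comment> \<open>This is the block for \<open>q = 0\<close> with an insertion before its last
    edge: the trajectory of \<open>Fall K\<close> and \<open>Rise (- K)\<close>, reflected only
    once, and the column \<open>4 * K - 1\<close>.\<close>
  define pre where "pre = [pt (6 * K - 1) (4 * K - 1), pt 0 (2 * (5 * K - 1)), pt 0 (2 * (- K - 2)),
    pt (6 * K - 1) (4 * K - 5), pt (2 * K - 1) (8 * K - 5), pt (6 * K) (2 * (6 * K - 2)), pt (6 * K) (- 2),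
    pt (2 * K - 1) (4 * K - 1), pt (2 * (4 * K - 1)) (2 * (5 * K - 1)),
    pt (2 * (4 * K - 1)) (2 * (2 - 3 * K)), pt (2 * K - 1) 3]"
  define pks where "pks = [Rise 0, Fall (2 * K), Vert 0, Rise 1, Fall (2 * K - 1), Rise (1 - 2 * K), Vert (3 * K), Fall K,
    Rise (- K), Vert (4 * K - 1), Fall 1]"
  \<comment> \<open>The first three edges of the block for \<open>q = K - 1\<close>. Its next line,
    \<open>Rise K\<close>, would meet no grid point of the box; the chain returns to
    \<open>u\<close> instead, where \<open>Rise 0\<close> starts.\<close>
  define suf where "suf = [pt (6 * K - 1) (8 * K - 5), pt (2 * (K - 1)) (2 * (6 * K - 2)), u]"
  define sks where "sks = [Rise (1 - K), Fall (3 * K - 1), Vert (K - 1)]"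
  define mks where "mks = body_keys K 1 (k - 2) 0 (3 * K)"
  have pre: "covers (4 * k) \<kappa> (dir 0 0) u pre pks" "last (u # pre) = pt (2 * K - 1) (4 * 1 - 1)"
    unfolding u_def pre_def pks_def covers.simps
     apply (intro conjI TrueI; (rule lay_rise | rule lay_fall | rule lay_vert_pt); use K fr in \<open>simp add: min_def max_def\<close>)
    by simp
  have suf: "covers (4 * k) \<kappa> (dir 0 0) (pt (2 * K - 1) (4 * (1 + int (k - 2)) - 1)) suf sks"
    unfolding u_def suf_def sks_def covers.simps
    by (intro conjI TrueI; (rule lay_rise | rule lay_fall | rule lay_vert_pt); use K fr in \<open>simp add: min_def max_def\<close>)
  have "covers (4 * k) \<kappa> (dir 0 0) u (pre @ body K K 1 (k - 2) 0 (3 * K) @ suf) (pks @ mks @ sks)"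
    unfolding mks_def
    by (rule covers_sandwich[OF pre covers_body suf]) (use K fr in auto)
  then have "exact_chain (4 * k) (u # pre @ body K K 1 (k - 2) 0 (3 * K) @ suf) (2 * (4 * k) - 2)"
  proof (rule exact_chain_covers[where ?x0.0 = K and ?y0.0 = 0])
    show "length (pks @ mks @ sks) = 2 * (4 * k) - 2"
      using k by (simp add: pks_def mks_def sks_def)
    show "successively (\<lambda>k l. cross (dir 0 0 k) (dir 0 0 l) \<noteq> 0) (pks @ mks @ sks)"
      unfolding mks_def
      by (rule successively_body) (simp_all add: pks_def sks_def blk_keys_def cross_dir_simps)
    show "\<kappa> x y \<in> set (pks @ mks @ sks)" if xy: "x \<in> {0..<int (4 * k)}" "y \<in> {0..<int (4 * k)}" for x y
    proof -
      have r: "0 \<le> x" "x < 4 * K" "0 \<le> y" "y < 4 * K" using xy K by auto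
      show ?thesis
      proof (cases x y rule: \<kappa>_cases)
        case sp
        then show ?thesis by simp
      next
        case Vert
        \<comment> \<open>The single values are the keys of the two end parts; the ranges are those
          found in the periodic part.\<close>
        then have "x = 0 \<or> x = K - 1 \<or> x = 3 * K \<or> x = 4 * K - 1
          \<or> (1 \<le> x \<and> x < K - 1 \<or> 1 \<le> x - 3 * K \<and> x - 3 * K < K - 1)" using r K(1) by linarith
        then show ?thesis unfolding Vert(2) mks_def
          by (elim disjE) (simp_all add: pks_def sks_def vert_mem_body_keys K)
      next
        case (Rise i)
        then have "i = 0 \<or> i = 1 \<or> i = 1 - 2 * K \<or> i = - K \<or> i = 1 - K
          \<or> (1 \<le> - i \<and> - i < K - 1 \<or> 1 \<le> i - 1 \<and> i - 1 < K - 1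
          \<or> 1 \<le> i - 1 + 2 * K \<and> i - 1 + 2 * K < K - 1)"
          using r K(1) by linarith
        then show ?thesis unfolding Rise(2) mks_def
          by (elim disjE) (simp_all add: pks_def sks_def rise_mem_body_keys K)
      next
        case (Fall i)
        then have "i = 1 \<or> i = K \<or> i = 2 * K - 1 \<or> i = 2 * K \<or> i = 3 * K - 1
          \<or> (1 \<le> i - 1 \<and> i - 1 < K - 1 \<or> 1 \<le> 2 * K - 1 - i \<and> 2 * K - 1 - i < K - 1
          \<or> 1 \<le> i - 2 * K \<and> i - 2 * K < K - 1)"
          using r K(1) by linarith
        then show ?thesis unfolding Fall(2) mks_def
          by (elim disjE) (simp_all add: pks_def sks_def fall_mem_body_keys K)
      qed
    qed
    show "snd (dir 0 0 (\<kappa> x 0)) \<noteq> 0" for x by (simp add: \<kappa>_def dir_def)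
    show "fst (dir 0 0 (\<kappa> K y)) \<noteq> 0" for y using K by (simp add: \<kappa>_def dir_def)
    show "last (pre @ body K K 1 (k - 2) 0 (3 * K) @ suf) \<notin> grid (4 * k)"
      by (simp add: suf_def u_def pt_grid)
  qed (use k K in auto)
  moreover have "hd (u # pre @ body K K 1 (k - 2) 0 (3 * K) @ suf) = last (u # pre @ body K K 1 (k - 2) 0 (3 * K) @ suf)"
    by (simp add: suf_def)
  ultimately show ?thesis by blast
qed

text \<open>Here the box consists of all columns but the two outermost ones, and both trajectories are
  reflected at the top and bottom as well.\<close>

definition zig :: "int \<Rightarrow> int \<Rightarrow> chain" where
  "zig k i = [pt (8 * k - 8 * i - 3) (8 * k + 3), pt 1 (8 * i + 7), pt (8 * i + 9) (- 1),
    pt (8 * k + 1) (8 * k - 8 * i - 9)]"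

definition zig_keys :: "int \<Rightarrow> int \<Rightarrow> key list" where
  "zig_keys k i = [Fall (4 * k - 2 * i), Rise (- 2 * i - 2), Fall (2 * i + 2), Rise (2 * i + 2)]"

definition zag :: "int \<Rightarrow> int \<Rightarrow> chain" where
  "zag k i = [pt (8 * i + 5) (- 1), pt (8 * k + 1) (8 * k - 8 * i - 5), pt (8 * k - 8 * i - 7) (8 * k + 3),
    pt 1 (8 * i + 11)]"

definition zag_keys :: "int \<Rightarrow> int \<Rightarrow> key list" where
  "zag_keys k i = [Fall (2 * i + 1), Rise (2 * i + 1), Fall (4 * k - 1 - 2 * i), Rise (- 2 * i - 3)]"

lemma mem_concat_map_upt:
  assumes "0 \<le> i" "i < int m" "\<xi> \<in> set (f i)"
  shows "\<xi> \<in> set (concat (map (\<lambda>j. f (int j)) [0..<m]))"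
  using assms by (auto intro!: bexI[of _ "nat i"])

text \<open>Reflection at any of the four sides preserves the parity of the index of a line, so
  there are two trajectories: \<open>zig\<close> belongs to the one on the even lines,
  \<open>zag\<close> to the one on the odd lines. Both run between the two outer columns, one with
  its ends below the grid, the other above, and the two vertical lines join them to a cycle.\<close>

lemma cycle_4k2:
  assumes k: "1 \<le> k"
  shows "\<exists>vs. exact_chain (4 * k + 2) vs (2 * (4 * k + 2) - 2) \<and> hd vs = last vs"
proof -
  define K where "K = int k"
  have K: "1 \<le> K" "int (4 * k + 2) = 4 * K + 2" "int (k - 1) = K - 1" using k by (auto simp: K_def)
  interpret box "4 * k + 2" 1 "4 * K" "\<lambda>_ _. None" 0 0
    by unfold_locales auto
  have fr: "free_rise i" "free_fall i" "free_vert i" for i by (simp_all add: free_rise_def free_fall_def free_vert_def)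
  let ?C = "\<lambda>f. concat (map (\<lambda>j. f K (int j)) [0..<k - 1])"
  let ?zig = "?C zig" and ?zag = "?C zag" and ?zigk = "?C zig_keys" and ?zagk = "?C zag_keys"
  define u where "u = pt 0 (- 2)"
  define a where "a = [pt (8 * K + 1) (8 * K - 1)]"
  define b where "b = [pt 5 (8 * K + 3), pt 1 (8 * K - 1), pt (8 * K + 2) (- 2), pt (8 * K + 2) (8 * K + 4), pt 1 3]"
  define c where "c = [pt (8 * K - 3) (- 1), pt (8 * K + 1) 3, pt 0 (8 * K + 4), u]"
  define ak where "ak = [Rise 0]"
  define bk where "bk = [Fall (2 * K + 2), Rise (- 2 * K), Fall (2 * K), Vert (4 * K + 1), Rise (- 1)]"
  define ck where "ck = [Fall (2 * K - 1), Rise (2 * K - 1), Fall (2 * K + 1), Vert 0]"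
  \<comment> \<open>A round of \<open>zig\<close> or \<open>zag\<close> touches all four sides and
    comes back shifted by four rows, \<open>8\<close> in doubled coordinates.\<close>
  define w where "w = (\<lambda>j. pt (8 * K + 1) (8 * K - 8 * int j - 1))"
  define z where "z = (\<lambda>j. pt 1 (8 * int j + 3))"
  have a: "covers (4 * k + 2) \<kappa> (dir 0 0) u a ak" "last (u # a) = w 0"
    unfolding u_def a_def ak_def covers.simps
     apply (intro conjI TrueI; (rule lay_rise | rule lay_fall | rule lay_vert_pt); use K fr in \<open>simp add: min_def max_def\<close>)
    by (simp add: w_def)
  have b: "covers (4 * k + 2) \<kappa> (dir 0 0) (w (k - 1)) b bk" "last (w (k - 1) # b) = z 0"
    unfolding w_def b_def bk_def covers.simps
     apply (intro conjI TrueI; (rule lay_rise | rule lay_fall | rule lay_vert_pt); use K fr in \<open>simp add: min_def max_def\<close>)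
    by (simp add: z_def)
  have c: "covers (4 * k + 2) \<kappa> (dir 0 0) (z (k - 1)) c ck"
    unfolding z_def c_def ck_def u_def covers.simps
    by (intro conjI TrueI; (rule lay_rise | rule lay_fall | rule lay_vert_pt); use K fr in \<open>simp add: min_def max_def\<close>)
  have zig: "covers (4 * k + 2) \<kappa> (dir 0 0) (w 0) ?zig ?zigk \<and> last (w 0 # ?zig) = w (k - 1)"
  proof (rule covers_concat, rule conjI)
    fix j assume "j < k - 1"
    then have j: "0 \<le> int j" "int j \<le> K - 2" using K by linarith+
    show "covers (4 * k + 2) \<kappa> (dir 0 0) (w j) (zig K (int j)) (zig_keys K (int j))"
      unfolding w_def zig_def zig_keys_def covers.simps
      by (intro conjI TrueI; (rule lay_rise | rule lay_fall | rule lay_vert_pt); use K fr j in \<open>simp add: min_def max_def\<close>)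
    show "last (w j # zig K (int j)) = w (Suc j)" by (simp add: zig_def w_def algebra_simps)
  qed
  have zag: "covers (4 * k + 2) \<kappa> (dir 0 0) (z 0) ?zag ?zagk \<and> last (z 0 # ?zag) = z (k - 1)"
  proof (rule covers_concat, rule conjI)
    fix j assume "j < k - 1"
    then have j: "0 \<le> int j" "int j \<le> K - 2" using K by linarith+
    show "covers (4 * k + 2) \<kappa> (dir 0 0) (z j) (zag K (int j)) (zag_keys K (int j))"
      unfolding z_def zag_def zag_keys_def covers.simps
      by (intro conjI TrueI; (rule lay_rise | rule lay_fall | rule lay_vert_pt); use K fr j in \<open>simp add: min_def max_def\<close>)
    show "last (z j # zag K (int j)) = z (Suc j)" by (simp add: zag_def z_def algebra_simps)
  qed
  let ?vs = "a @ ?zig @ b @ ?zag @ c" and ?ks = "ak @ ?zigk @ bk @ ?zagk @ ck"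
  have "covers (4 * k + 2) \<kappa> (dir 0 0) u ?vs ?ks"
    using covers_sandwich[OF a conjunct1[OF zig] conjunct2[OF zig]
        covers_sandwich[OF b conjunct1[OF zag] conjunct2[OF zag] c]] .
  then have "exact_chain (4 * k + 2) (u # ?vs) (2 * (4 * k + 2) - 2)"
  proof (rule exact_chain_covers[where ?x0.0 = 1 and ?y0.0 = 0])
    show "length ?ks = 2 * (4 * k + 2) - 2"
      using k by (simp add: ak_def bk_def ck_def zig_keys_def zag_keys_def length_concat comp_def sum_list_triv)
    show "successively (\<lambda>k l. cross (dir 0 0 k) (dir 0 0 l) \<noteq> 0) ?ks"
    proof (rule successively_concat)
      show "successively (\<lambda>k l. cross (dir 0 0 k) (dir 0 0 l) \<noteq> 0) (bk @ ?zagk @ ck)"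
        by (rule successively_concat) (simp_all add: bk_def ck_def zag_keys_def cross_dir_simps)
    qed (simp_all add: ak_def bk_def zig_keys_def cross_dir_simps)
    show "\<kappa> x y \<in> set ?ks" if xy: "x \<in> {0..<int (4 * k + 2)}" "y \<in> {0..<int (4 * k + 2)}" for x y
    proof -
      have r: "0 \<le> x" "x < 4 * K + 2" "0 \<le> y" "y < 4 * K + 2" using xy K by auto
      note mem = mem_concat_map_upt[where m = "k - 1" and f = "zig_keys K"]
        mem_concat_map_upt[where m = "k - 1" and f = "zag_keys K"]
      show ?thesis
      proof (cases x y rule: \<kappa>_cases)
        case sp
        then show ?thesis by simp
      next
        case Vert
        then have "x = 0 \<or> x = 4 * K + 1" using r K(1) by linarith
        then show ?thesis unfolding Vert(2) by (auto simp: bk_def ck_def)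
      next
        case (Rise i)
        show ?thesis
        proof (cases "even i")
          case True
          then obtain j where j: "i = 2 * j" by blast
          then have "j = 0 \<or> j = - K \<or> (0 \<le> j - 1 \<and> j - 1 < K - 1 \<or> 0 \<le> - j - 1 \<and> - j - 1 < K - 1)"
            using Rise r K(1) by linarith
          then show ?thesis unfolding Rise(2) j
            using mem(1)[of "j - 1" "Rise (2 * j)"] mem(1)[of "- j - 1" "Rise (2 * j)"] K(3)
            by (elim disjE) (simp_all add: ak_def bk_def zig_keys_def)
        next
          case False
          then obtain j where j: "i = 2 * j + 1" by (elim oddE)
          then have "j = - 1 \<or> j = K - 1 \<or> (0 \<le> j \<and> j < K - 1 \<or> 0 \<le> - j - 2 \<and> - j - 2 < K - 1)"
            using Rise r K(1) by linarith
          then show ?thesis unfolding Rise(2) j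
            using mem(2)[of "j" "Rise (2 * j + 1)"] mem(2)[of "- j - 2" "Rise (2 * j + 1)"] K(3)
            by (elim disjE) (simp_all add: bk_def ck_def zag_keys_def)
        qed
      next
        case (Fall i)
        show ?thesis
        proof (cases "even i")
          case True
          then obtain j where j: "i = 2 * j" by blast
          then have "j = K + 1 \<or> j = K \<or> (0 \<le> j - 1 \<and> j - 1 < K - 1 \<or> 0 \<le> 2 * K - j \<and> 2 * K - j < K - 1)"
            using Fall r K(1) by linarith
          then show ?thesis unfolding Fall(2) j
            using mem(1)[of "j - 1" "Fall (2 * j)"] mem(1)[of "2 * K - j" "Fall (2 * j)"] K(3)
            by (elim disjE) (simp_all add: ak_def bk_def zig_keys_def)
        next
          case False
          then obtain j where j: "i = 2 * j + 1" by (elim oddE)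
          then have "j = K - 1 \<or> j = K \<or> (0 \<le> j \<and> j < K - 1 \<or> 0 \<le> 2 * K - 1 - j \<and> 2 * K - 1 - j < K - 1)"
            using Fall r K(1) by linarith
          then show ?thesis unfolding Fall(2) j
            using mem(2)[of "j" "Fall (2 * j + 1)"] mem(2)[of "2 * K - 1 - j" "Fall (2 * j + 1)"] K(3)
            by (elim disjE) (simp_all add: bk_def ck_def zag_keys_def)
        qed
      qed
    qed
    show "snd (dir 0 0 (\<kappa> x 0)) \<noteq> 0" for x by (simp add: \<kappa>_def dir_def)
    show "fst (dir 0 0 (\<kappa> 1 y)) \<noteq> 0" for y using K by (simp add: \<kappa>_def dir_def)
    show "last ?vs \<notin> grid (4 * k + 2)" by (simp add: c_def u_def pt_grid)
  qed (use k K in auto)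
  moreover have "hd (u # ?vs) = last (u # ?vs)" by (simp add: c_def)
  ultimately show ?thesis by blast
qed

section \<open>Odd side length\<close>

text \<open>For finding the grid points on a steep line: these are indexed by a multiplier
  \<open>d\<close>, and the height of the grid leaves two values for it.\<close>

lemma multiple_unit_interval:
  fixes c d :: int
  assumes "0 < c" "- c < c * d" "c * d \<le> c"
  shows "d = 0 \<or> d = 1"
proof -
  have "c * (- 1) < c * d" "c * d \<le> c * 1" using assms(2,3) by simp_all
  then have "- 1 < d" "d \<le> 1" using assms(1) by (simp_all only: mult_less_cancel_left_pos mult_le_cancel_left_pos)
  then show ?thesis by linarith
qed

lemma (in box) \<kappa>_steep: "\<kappa> x y = Steep m \<longleftrightarrow> sp x y = Some (Steep m)"
  by (auto simp: \<kappa>_def split: option.splits)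

lemma (in box) lay_steep:
  assumes "k = Steep m" "x1 \<noteq> x2" "y2 - y1 = (if m then s else t) * (x2 - x1)"
    and "\<And>x y. x \<in> {0..<int n} \<Longrightarrow> y \<in> {0..<int n} \<Longrightarrow>
      of_int y - y1 = (if m then s else t) * (of_int x - x1) \<and> min x1 x2 \<le> of_int x \<and> of_int x \<le> max x1 x2 \<and>
      of_int x \<noteq> x2 \<longleftrightarrow> sp x y = Some (Steep m)"
  shows "lay (x1, y1) (x2, y2) k"
  by (rule lays_slope[where s = "if m then s else t"]) (use assms in \<open>simp_all add: dir_def \<kappa>_steep\<close>)

lemma (in box) fst_dir_\<kappa>:
  assumes "L \<le> x" "x < L + b"
  shows "fst (dir s t (\<kappa> x y)) \<noteq> 0"
proof (cases "\<kappa> x y")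
  case (Vert c)
  then show ?thesis using assms by (simp add: \<kappa>_vert)
qed (simp_all add: dir_def)

text \<open>For odd \<open>n\<close> the reflected lines would be one too many, as two of them pass a single point, at a
  corner of the box. They and the two-point line next to another corner give way to two steep lines.\<close>

lemma path_4k1:
  assumes k: "2 \<le> k"
  shows "\<exists>vs. exact_chain (4 * k + 1) vs (2 * (4 * k + 1) - 2)"
proof -
  define K where "K = int k"
  have K: "2 \<le> K" "int (4 * k + 1) = 4 * K + 1" "int (k - 2) = K - 2" using k by (auto simp: K_def)
  \<comment> \<open>\<open>Rise (- 2 * K)\<close> and \<open>Fall (3 * K)\<close> have one grid
    point each, in the top corners of the box; \<open>Fall 1\<close> has the two points next to the
    lower left corner. Each steep line joins a point of \<open>Fall 1\<close> to one of the other
    two.\<close>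
  define sp where "sp = (\<lambda>x y. if x = K + 1 \<and> y = 4 * K \<or> x = K + 2 \<and> y = 0 then Some (Steep True)
    else if x = K + 1 \<and> y = 1 \<or> x = 3 * K \<and> y = 4 * K then Some (Steep False) else None)"
  define t :: real where "t = of_int (4 * K - 1) / of_int (2 * K - 1)"
  define s :: real where "s = of_int (- 4 * K)"
  interpret box "4 * k + 1" "K + 1" "2 * K" sp s t
    by unfold_locales (auto simp: sp_def split: if_splits)
  have fE: "free_rise i" if "i \<noteq> - 2 * K" for i using that unfolding free_rise_def by (auto simp: sp_def; presburger)
  have fF: "free_fall i" if "i \<noteq> 1" "i \<noteq> 3 * K" for i using that K unfolding free_fall_def by (auto simp: sp_def; presburger)
  have fV: "free_vert c" if "c < K + 1 \<or> 3 * K < c" for c using that K unfolding free_vert_def by (auto simp: sp_def)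
  have t_gt: "2 < t" using K by (simp add: t_def field_simps)
  have t_mult: "t * of_int (2 * K - 1) = of_int (4 * K - 1)" using K by (simp add: t_def)
  \<comment> \<open>The reflection point of \<open>Fall 1\<close> and \<open>Rise (- 1)\<close>: as
    \<open>Fall 1\<close> is replaced, the chain begins here.\<close>
  define u where "u = pt (2 * K + 1) 3"
  \<comment> \<open>The vertices with products of \<open>K\<close> or with \<open>t\<close>, and the
    one at height \<open>12 * K\<close>, are the points where the steep lines meet the columns
    \<open>3 * K + 1\<close>, \<open>K - 1\<close>, \<open>K\<close> and
    \<open>4 * K\<close>.\<close>
  define suf where "suf = [pt (6 * K + 1) (8 * K - 5), pt 0 (2 * (7 * K - 2)), pt 0 (2 * (- K - 3)),
    pt (6 * K + 1) (4 * K - 5), pt (2 * K + 1) (8 * K - 5), pt (2 * (3 * K + 1)) (2 * (6 * K - 2)),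
    pt (2 * (3 * K + 1)) (2 * (4 * K * (1 - 2 * K))), pt (2 * (K - 1)) (2 * (12 * K)), pt (2 * (K - 1)) (- 4),
    pt (6 * K + 1) (4 * K - 1), pt (2 * K) (2 * (4 * K)), (of_int K, 1 - t),
    (of_int (4 * K), 1 + t * of_int (3 * K - 1)), pt (2 * (4 * K)) (2 * (- K)), pt (2 * K + 1) (4 * K - 1),
    pt (6 * K + 1) (8 * K - 1)]"
  define sks where "sks = [Rise (1 - K), Fall (3 * K - 1), Vert 0, Rise 1, Fall (2 * K - 1), Rise (1 - 2 * K), Vert (3 * K + 1),
    Steep True, Vert (K - 1), Rise 0, Fall (2 * K), Vert K, Steep False, Vert (4 * K), Fall K, Rise (- K)]"
  define mks where "mks = body_keys K 1 (k - 2) 0 (3 * K + 1)"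
  let ?mid = "body (K + 1) K 1 (k - 2) 0 (3 * K + 1)"
  have ptV: "pt (2 * c) (2 * d) = (of_int c, of_int d)" for c d by (simp add: pt_def)
  have neg: "4 * K * (1 - 2 * K) < 0" using K by (simp add: mult_less_0_iff)
  have e7: "lay (pt (2 * (3 * K + 1)) (2 * (6 * K - 2))) (pt (2 * (3 * K + 1)) (2 * (4 * K * (1 - 2 * K)))) (Vert (3 * K + 1))"
    by (rule lay_vert_pt) (use K fV neg in simp_all)
  have e8: "lay (pt (2 * (3 * K + 1)) (2 * (4 * K * (1 - 2 * K)))) (pt (2 * (K - 1)) (2 * (12 * K))) (Steep True)"
    unfolding ptV
  proof (rule lay_steep[OF refl])
    fix x y assume "x \<in> {0..<int (4 * k + 1)}" "y \<in> {0..<int (4 * k + 1)}"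
    then have r: "0 \<le> x" "x \<le> 4 * K" "0 \<le> y" "y \<le> 4 * K" using K by auto
    have "real_of_int y - of_int (4 * K * (1 - 2 * K)) = s * (of_int x - of_int (3 * K + 1)) \<longleftrightarrow>
        real_of_int y = of_int (4 * K * (K + 2 - x))"
      by (simp add: s_def algebra_simps)
    also have "\<dots> \<longleftrightarrow> y = 4 * K * (K + 2 - x)" by (rule of_int_eq_iff)
    also have "\<dots> \<longleftrightarrow> x = K + 1 \<and> y = 4 * K \<or> x = K + 2 \<and> y = 0"
      using multiple_unit_interval[of "4 * K" "K + 2 - x"] r K by auto
    finally have line: "real_of_int y - of_int (4 * K * (1 - 2 * K)) = s * (of_int x - of_int (3 * K + 1)) \<longleftrightarrow>
        sp x y = Some (Steep True)" by (simp add: sp_def)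
    moreover have "K - 1 < x \<and> x < 3 * K + 1" if "sp x y = Some (Steep True)"
      using that K by (auto simp: sp_def split: if_splits)
    ultimately show "real_of_int y - of_int (4 * K * (1 - 2 * K)) = (if True then s else t) * (of_int x - of_int (3 * K + 1)) \<and>
        min (of_int (3 * K + 1)) (of_int (K - 1)) \<le> real_of_int x \<and> of_int x \<le> max (real_of_int (3 * K + 1)) (of_int (K - 1)) \<and>
        real_of_int x \<noteq> of_int (K - 1) \<longleftrightarrow> sp x y = Some (Steep True)"
      by (simp add: min_def max_def) linarith
  qed (use K in \<open>simp_all add: s_def algebra_simps\<close>)
  \<comment> \<open>This edge ends at the top grid point of column \<open>K\<close>, next to the
    box; that point is counted for the vertical edge leading away from it.\<close>
  have e11: "lay (pt (6 * K + 1) (4 * K - 1)) (pt (2 * K) (2 * (4 * K))) (Fall (2 * K))"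
    by (rule lay_fall_raw) (use K fF[of "2 * K"] in \<open>auto simp: min_def max_def free_fall_def\<close>)
  have e12: "lay (pt (2 * K) (2 * (4 * K))) (of_int K, 1 - t) (Vert K)"
    unfolding ptV
  proof (rule lay_vert)
    fix y assume "y \<in> {0..<int (4 * k + 1)}"
    then have "0 \<le> real_of_int y" "real_of_int y \<le> of_int (4 * K)" using K by (auto simp del: of_int_mult)
    then show "min (of_int (4 * K)) (1 - t) \<le> of_int y \<and> of_int y \<le> max (of_int (4 * K)) (1 - t) \<and>
        of_int y \<noteq> 1 - t \<longleftrightarrow> sp K y = None"
      using fV[of K] t_gt by (auto simp: free_vert_def)
  qed (use t_gt K in auto)
  have e13: "lay (of_int K, 1 - t) (of_int (4 * K), 1 + t * of_int (3 * K - 1)) (Steep False)"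
  proof (rule lay_steep[OF refl])
    fix x y assume "x \<in> {0..<int (4 * k + 1)}" "y \<in> {0..<int (4 * k + 1)}"
    then have r: "0 \<le> x" "x \<le> 4 * K" "0 \<le> y" "y \<le> 4 * K" using K by auto
    define d e where "d = x - K - 1" and "e = y - 1"
    have "real_of_int y - (1 - t) = t * (of_int x - of_int K) \<longleftrightarrow> of_int e = t * of_int d"
      by (auto simp: d_def e_def algebra_simps)
    also have "\<dots> \<longleftrightarrow> real_of_int ((2 * K - 1) * e) = of_int ((4 * K - 1) * d)"
      using K by (simp add: t_def field_simps)
    also have "\<dots> \<longleftrightarrow> (2 * K - 1) * e = (4 * K - 1) * d" by (rule of_int_eq_iff)
    also have "\<dots> \<longleftrightarrow> d = 0 \<and> e = 0 \<or> d = 2 * K - 1 \<and> e = 4 * K - 1"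
    proof
      assume *: "(2 * K - 1) * e = (4 * K - 1) * d"
      \<comment> \<open>As \<open>4 * K - 1 = 2 * (2 * K - 1) + 1\<close>, the common multiplier of
        \<open>d\<close> and \<open>e\<close> is \<open>e - 2 * d\<close>.\<close>
      have d: "d = (2 * K - 1) * (e - 2 * d)" using * by (simp add: algebra_simps)
      have e: "e = (4 * K - 1) * (e - 2 * d)" using * d by (simp add: algebra_simps)
      have "- (4 * K - 1) < e" "e \<le> 4 * K - 1" using r K by (auto simp: e_def)
      then have "e - 2 * d = 0 \<or> e - 2 * d = 1"
        using multiple_unit_interval[of "4 * K - 1" "e - 2 * d"] e K by simp
      then show "d = 0 \<and> e = 0 \<or> d = 2 * K - 1 \<and> e = 4 * K - 1" using d e by auto
    qed auto
    also have "\<dots> \<longleftrightarrow> sp x y = Some (Steep False)" using K by (auto simp: sp_def d_def e_def)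
    finally have line: "real_of_int y - (1 - t) = t * (of_int x - of_int K) \<longleftrightarrow> sp x y = Some (Steep False)" .
    moreover have "K < x \<and> x < 4 * K" if "sp x y = Some (Steep False)"
      using that K by (auto simp: sp_def split: if_splits)
    ultimately show "real_of_int y - (1 - t) = (if False then s else t) * (of_int x - of_int K) \<and>
        min (of_int K) (of_int (4 * K)) \<le> real_of_int x \<and> of_int x \<le> max (real_of_int K) (of_int (4 * K)) \<and>
        real_of_int x \<noteq> of_int (4 * K) \<longleftrightarrow> sp x y = Some (Steep False)"
      using K by (simp add: min_def max_def) linarith
  qed (use K in \<open>simp_all add: algebra_simps\<close>)
  have e14: "lay (of_int (4 * K), 1 + t * of_int (3 * K - 1)) (pt (2 * (4 * K)) (2 * (- K))) (Vert (4 * K))"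
    unfolding ptV
  proof (rule lay_vert_full)
    have "2 * real_of_int (3 * K - 1) \<le> t * of_int (3 * K - 1)"
      using t_gt K by (intro mult_right_mono) auto
    then show "1 + t * of_int (3 * K - 1) < 0 \<and> real (4 * k + 1) - 1 < of_int (- K) \<or>
        real_of_int (- K) < 0 \<and> real (4 * k + 1) - 1 < 1 + t * of_int (3 * K - 1)"
      using K by (simp add: K_def)
  qed (use K fV in \<open>auto simp: free_vert_def\<close>)
  note special = e7 e8 e11 e12 e13 e14
  have suf: "covers (4 * k + 1) \<kappa> (dir s t) (pt (2 * (K + 1) - 1) (4 * (1 + int (k - 2)) - 1)) suf sks"
    unfolding suf_def sks_def covers.simps
    by (intro conjI TrueI; (rule special)?; (rule lay_rise | rule lay_fall | rule lay_vert_pt);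
      use K in \<open>simp add: min_def max_def fE fF fV\<close>)
  have "covers (4 * k + 1) \<kappa> (dir s t) u ([] @ ?mid @ suf) ([] @ mks @ sks)"
    unfolding mks_def
    by (rule covers_sandwich[OF _ _ covers_body suf]) (use K fE fF fV in \<open>auto simp: u_def algebra_simps\<close>)
  then have "covers (4 * k + 1) \<kappa> (dir s t) u (?mid @ suf) (mks @ sks)" by simp
  then have "exact_chain (4 * k + 1) (u # ?mid @ suf) (2 * (4 * k + 1) - 2)"
  proof (rule exact_chain_covers[where ?x0.0 = "K + 1" and ?y0.0 = 0])
    show "length (mks @ sks) = 2 * (4 * k + 1) - 2"
      using k by (simp add: mks_def sks_def)
    \<comment> \<open>\<open>successively_body\<close> asks for a nonempty first part;
      \<open>Vert 0\<close> is put in front as a dummy and dropped again.\<close>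
    have "successively (\<lambda>k l. cross (dir s t k) (dir s t l) \<noteq> 0) ([Vert 0] @ mks @ sks)"
      unfolding mks_def
      by (rule successively_body) (simp_all add: sks_def blk_keys_def cross_dir_simps)
    then show "successively (\<lambda>k l. cross (dir s t k) (dir s t l) \<noteq> 0) (mks @ sks)"
      by (auto simp: successively_Cons)
    show "\<kappa> x y \<in> set (mks @ sks)" if xy: "x \<in> {0..<int (4 * k + 1)}" "y \<in> {0..<int (4 * k + 1)}" for x y
    proof -
      have r: "0 \<le> x" "x < 4 * K + 1" "0 \<le> y" "y < 4 * K + 1" using xy K by auto
      show ?thesis
      proof (cases x y rule: \<kappa>_cases)
        case (sp k)
        then show ?thesis by (auto simp: sks_def sp_def split: if_splits)
      next
        case Vert
        then have "x = 0 \<or> x = K - 1 \<or> x = K \<or> x = 3 * K + 1 \<or> x = 4 * K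
          \<or> (1 \<le> x \<and> x < K - 1 \<or> 1 \<le> x - (3 * K + 1) \<and> x - (3 * K + 1) < K - 1)" using r K(1) by linarith
        then show ?thesis unfolding Vert(2) mks_def
          by (elim disjE) (simp_all add: sks_def vert_mem_body_keys K)
      next
        case (Rise i)
        have "i \<noteq> - 2 * K"
        proof
          assume "i = - 2 * K"
          then have "x = K + 1 \<and> y = 4 * K" using Rise r by linarith
          then show False using Rise(1) by (simp add: sp_def)
        qed
        then have "i = 0 \<or> i = 1 \<or> i = 1 - 2 * K \<or> i = - K \<or> i = 1 - K
          \<or> (1 \<le> - i \<and> - i < K - 1 \<or> 1 \<le> i - 1 \<and> i - 1 < K - 1
          \<or> 1 \<le> i - 1 + 2 * K \<and> i - 1 + 2 * K < K - 1)"
          using Rise r K(1) by linarith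
        then show ?thesis unfolding Rise(2) mks_def
          by (elim disjE) (simp_all add: sks_def rise_mem_body_keys K)
      next
        case (Fall i)
        have "i \<noteq> 1"
        proof
          assume "i = 1"
          then have "x = K + 1 \<and> y = 1 \<or> x = K + 2 \<and> y = 0" using Fall r by linarith
          then show False using Fall(1) by (auto simp: sp_def split: if_splits)
        qed
        moreover have "i \<noteq> 3 * K"
        proof
          assume "i = 3 * K"
          then have "x = 3 * K \<and> y = 4 * K" using Fall r by linarith
          then show False using Fall(1) by (simp add: sp_def split: if_splits)
        qed
        ultimately have "i = K \<or> i = 2 * K - 1 \<or> i = 2 * K \<or> i = 3 * K - 1
          \<or> (1 \<le> i - 1 \<and> i - 1 < K - 1 \<or> 1 \<le> 2 * K - 1 - i \<and> 2 * K - 1 - i < K - 1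
          \<or> 1 \<le> i - 2 * K \<and> i - 2 * K < K - 1)"
          using Fall r K(1) by linarith
        then show ?thesis unfolding Fall(2) mks_def
          by (elim disjE) (simp_all add: sks_def fall_mem_body_keys K)
      qed
    qed
    have "s \<noteq> 0" using K by (simp add: s_def)
    then show "snd (dir s t (\<kappa> x 0)) \<noteq> 0" for x using t_gt
      by (simp add: dir_def split: key.splits)
    show "fst (dir s t (\<kappa> (K + 1) y)) \<noteq> 0" for y by (rule fst_dir_\<kappa>) (use K in simp_all)
    show "last (?mid @ suf) \<notin> grid (4 * k + 1)"
      by (auto simp: suf_def pt_grid) presburger
  qed (use k K in auto)
  then show ?thesis by blast
qed

text \<open>The top of column \<open>K - 2\<close> is a vertex of the chain, and the edge leaving it is a falling one:
  hence the last exception in \<open>sp\<close>.\<close>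

lemma path_4k3:
  assumes k: "3 \<le> k"
  shows "\<exists>vs. exact_chain (4 * k - 1) vs (2 * (4 * k - 1) - 2)"
proof -
  define K where "K = int k"
  have K: "3 \<le> K" "int (4 * k - 1) = 4 * K - 1" "int (k - 3) = K - 3" using k by (auto simp: K_def)
  define sp where "sp = (\<lambda>x y. if x = K - 1 \<and> y = 4 * K - 2 \<or> x = K \<and> y = 0 then Some (Steep True)
    else if x = K - 1 \<and> y = 1 \<or> x = 3 * K - 2 \<and> y = 4 * K - 2 then Some (Steep False)
    else if x = K - 2 \<and> y = 4 * K - 2 then Some (Fall (2 * K - 1)) else None)"
  define t :: real where "t = of_int (4 * K - 3) / of_int (2 * K - 1)"
  define s :: real where "s = of_int (- (4 * K - 2))"
  \<comment> \<open>The line \<open>Steep False\<close> goes through \<open>(K - 1, 1)\<close>. It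
    meets \<open>Rise 1\<close> at abscissa \<open>K - 1 + \<nu>\<close>, to the left of the box and
    below the grid, where the chain passes from one to the other.\<close>
  define \<nu> :: real where "\<nu> = - 3 * of_int (2 * K - 1) / of_int (2 * K - 2)"
  interpret box "4 * k - 1" "K - 1" "2 * K" sp s t
    using k by unfold_locales (auto simp: sp_def split: if_splits)
  have fE: "free_rise i" if "i \<noteq> 1 - 2 * K" for i
    using that unfolding free_rise_def by (auto simp: sp_def; presburger)
  have fF: "free_fall i" if "i \<noteq> 1" "i \<noteq> 3 * K - 1" "i \<noteq> 2 * K - 1" for i
    using that K unfolding free_fall_def by (auto simp: sp_def; presburger)
  have fV: "free_vert c" if "c < K - 2 \<or> 3 * K - 2 < c" for c
    using that K unfolding free_vert_def by (auto simp: sp_def)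
  have t_gt: "1 < t" using K by (simp add: t_def field_simps)
  have t_mult: "t * of_int (2 * K - 1) = of_int (4 * K - 3)" using K by (simp add: t_def)
  have \<nu>_neg: "\<nu> < 0" using K by (simp add: \<nu>_def field_simps)
  have \<nu>: "\<nu> - 2 = 1 + t * \<nu>"
  proof -
    define p r where "p = real_of_int (2 * K - 1)" and "r = real_of_int (2 * K - 2)"
    have "p \<noteq> 0" "r \<noteq> 0" using K by (auto simp: p_def r_def)
    moreover have "real_of_int (4 * K - 3) = p + r" by (simp add: p_def r_def)
    ultimately have "\<nu> * (t - 1) = - 3"
      unfolding \<nu>_def t_def p_def[symmetric] r_def[symmetric] by (simp add: field_simps)
    then show ?thesis by (simp add: algebra_simps)
  qed
  define u where "u = pt (2 * K - 3) 3"
  \<comment> \<open>The second vertex has height \<open>n - 1 / 2\<close>: here a trajectory is also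
    reflected above the top row.\<close>
  define pre where "pre = [pt (6 * K - 3) (4 * K + 3), pt (2 * K + 3) (8 * K - 3), pt (2 * K - 3) (8 * K - 9),
    pt (6 * K - 3) (4 * K - 9), pt 0 (2 * (- K - 3)), pt 0 (2 * (5 * K - 2)), pt (6 * K - 3) (4 * K - 1),
    pt (2 * (K - 2)) (2 * (- 1)), pt (2 * (K - 2)) (2 * (4 * K - 2)), pt (6 * K - 3) (4 * K - 5),
    (of_int (K - 1) + \<nu>, \<nu> - 2), (of_int (3 * K), 1 + t * of_int (2 * K + 1)), pt (2 * (3 * K)) (2 * (2 - 2 * K)),
    pt (2 * K - 3) 7]"
  define pks where "pks = [Rise (- 1), Fall (2 * K + 1), Rise (2 - 2 * K), Fall (2 * K - 2), Rise 2, Vert 0, Fall (2 * K), Rise 0,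
    Vert (K - 2), Fall (2 * K - 1), Rise 1, Steep False, Vert (3 * K), Fall 2]"
  define suf where "suf = [pt (2 * (3 * K - 1)) (2 * (4 * K - 2)), pt (2 * (3 * K - 1)) (2 * (- 1)), pt (2 * K - 3) (4 * K - 1),
    pt (2 * (4 * K - 2)) (2 * (5 * K - 1)), pt (2 * (4 * K - 2)) (2 * ((4 * K - 2) * (2 - 3 * K))),
    pt (2 * K - 3) (3 * (4 * K - 2))]"
  define sks where "sks = [Rise (1 - K), Vert (3 * K - 1), Fall K, Rise (- K), Vert (4 * K - 2), Steep True]"
  define mks where "mks = body_keys K 2 (k - 3) (- 1) (3 * K - 1)"
  let ?mid = "body (K - 1) K 2 (k - 3) (- 1) (3 * K - 1)"
  have ptV: "pt (2 * c) (2 * d) = (of_int c, of_int d)" for c d by (simp add: pt_def)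
  have neg: "(4 * K - 2) * (2 - 3 * K) < 0" using K by (simp add: mult_less_0_iff)
  have range: "0 \<le> x \<and> x \<le> 4 * K - 2 \<and> 0 \<le> y \<and> y \<le> 4 * K - 2"
    if "x \<in> {0..<int (4 * k - 1)}" "y \<in> {0..<int (4 * k - 1)}" for x y
    using that K by auto
  have range_real: "0 \<le> real_of_int y" "real_of_int y \<le> of_int (4 * K - 2)" if "y \<in> {0..<int (4 * k - 1)}" for y
  proof -
    have "0 \<le> y" "y \<le> 4 * K - 2" using range[OF that that] by simp_all
    then show "0 \<le> real_of_int y" "real_of_int y \<le> of_int (4 * K - 2)"
      by (simp_all only: of_int_le_iff of_int_0_le_iff)
  qed
  have p9: "lay (pt (2 * (K - 2)) (2 * (- 1))) (pt (2 * (K - 2)) (2 * (4 * K - 2))) (Vert (K - 2))"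
    unfolding ptV
  proof (rule lay_vert)
    fix y assume y: "y \<in> {0..<int (4 * k - 1)}"
    have r: "0 \<le> y" "y \<le> 4 * K - 2" using range[OF y y] by simp_all
    have "min (of_int (- 1)) (of_int (4 * K - 2)) \<le> real_of_int y \<and>
        real_of_int y \<le> max (of_int (- 1)) (of_int (4 * K - 2)) \<and> real_of_int y \<noteq> of_int (4 * K - 2) \<longleftrightarrow> y \<noteq> 4 * K - 2"
      unfolding of_int_min[symmetric] of_int_max[symmetric] of_int_le_iff of_int_eq_iff
      using r K by (auto simp: min_def max_def)
    also have "\<dots> \<longleftrightarrow> sp (K - 2) y = None" using K by (auto simp: sp_def)
    finally show "min (of_int (- 1)) (of_int (4 * K - 2)) \<le> real_of_int y \<and>
        real_of_int y \<le> max (of_int (- 1)) (of_int (4 * K - 2)) \<and> real_of_int y \<noteq> of_int (4 * K - 2) \<longleftrightarrow> sp (K - 2) y = None" .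
  qed (use K in simp_all)
  have p10: "lay (pt (2 * (K - 2)) (2 * (4 * K - 2))) (pt (6 * K - 3) (4 * K - 5)) (Fall (2 * K - 1))"
  proof (rule lay_fall_raw)
    fix x y assume dom: "x \<in> {0..<int (4 * k - 1)}" "y \<in> {0..<int (4 * k - 1)}" and xy: "x + y = K - 1 + 2 * (2 * K - 1) - 1"
    have r: "0 \<le> x" "x \<le> 4 * K - 2" "0 \<le> y" "y \<le> 4 * K - 2" using range[OF dom] by simp_all
    have "sp x y = (if x = K - 2 then Some (Fall (2 * K - 1)) else None)" using xy K by (auto simp: sp_def)
    moreover have "2 * x \<noteq> 6 * K - 3" by presburger
    ultimately show "min (2 * (K - 2)) (6 * K - 3) \<le> 2 * x \<and> 2 * x \<le> max (2 * (K - 2)) (6 * K - 3) \<and> 2 * x \<noteq> 6 * K - 3 \<longleftrightarrow>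
        sp x y = Some (Fall (2 * K - 1)) \<or> sp x y = None \<and> K - 1 \<le> x \<and> x < K - 1 + 2 * K"
      using xy r K by (auto simp: min_def max_def)
  qed (use K in auto)
  have p11: "lay (pt (6 * K - 3) (4 * K - 5)) (of_int (K - 1) + \<nu>, \<nu> - 2) (Rise 1)"
  proof (rule lays_slope[where s = 1])
    fix x y assume xy: "x \<in> {0..<int (4 * k - 1)}" "y \<in> {0..<int (4 * k - 1)}"
    have r: "0 \<le> y" using range[OF xy] by simp
    have "real_of_int y - of_int (4 * K - 5) / 2 = 1 * (of_int x - of_int (6 * K - 3) / 2) \<longleftrightarrow>
        real_of_int (x - y) = of_int (K + 1)" by (simp add: field_simps) linarith
    then have line: "real_of_int y - of_int (4 * K - 5) / 2 = 1 * (of_int x - of_int (6 * K - 3) / 2) \<longleftrightarrow> x - y = K + 1"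
      unfolding of_int_eq_iff .
    have lt: "of_int (K - 1) + \<nu> < of_int x" if "x - y = K + 1"
    proof -
      have "real_of_int (K - 1) \<le> of_int x" using that r by (simp only: of_int_le_iff)
      then show ?thesis using \<nu>_neg by linarith
    qed
    have "of_int (K - 1) + \<nu> < of_int (6 * K - 3) / 2" using \<nu>_neg K by simp
    then have minmax: "min (of_int (6 * K - 3) / 2) (of_int (K - 1) + \<nu>) = of_int (K - 1) + \<nu>"
      "max (of_int (6 * K - 3) / 2) (of_int (K - 1) + \<nu>) = of_int (6 * K - 3) / 2" by simp_all
    have "x - y = K + 1 \<and> of_int (K - 1) + \<nu> \<le> of_int x \<and> of_int x \<le> real_of_int (6 * K - 3) / 2 \<and>
        of_int x \<noteq> of_int (K - 1) + \<nu> \<longleftrightarrow> x - y = K + 1 \<and> 2 * x \<le> 6 * K - 3"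
      using lt unfolding int_half_simps by auto
    also have "\<dots> \<longleftrightarrow> \<kappa> x y = Rise 1"
      using fE[of 1] K r by (auto simp: \<kappa>_rise free_rise_def)
    finally show "of_int y - snd (pt (6 * K - 3) (4 * K - 5)) = 1 * (of_int x - fst (pt (6 * K - 3) (4 * K - 5))) \<and>
      min (fst (pt (6 * K - 3) (4 * K - 5))) (fst (of_int (K - 1) + \<nu>, \<nu> - 2)) \<le> of_int x \<and>
      of_int x \<le> max (fst (pt (6 * K - 3) (4 * K - 5))) (fst (of_int (K - 1) + \<nu>, \<nu> - 2)) \<and>
      of_int x \<noteq> fst (of_int (K - 1) + \<nu>, \<nu> - 2) \<longleftrightarrow> \<kappa> x y = Rise 1"
      unfolding pt_def fst_conv snd_conv line minmax .
  next
    have "of_int (K - 1) + \<nu> < of_int (6 * K - 3) / 2" using \<nu>_neg K by simp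
    then show "fst (pt (6 * K - 3) (4 * K - 5)) \<noteq> fst (of_int (K - 1) + \<nu>, \<nu> - 2)" by (simp add: pt_def)
  qed (simp_all add: pt_def dir_def field_simps)
  have p12: "lay (of_int (K - 1) + \<nu>, \<nu> - 2) (of_int (3 * K), 1 + t * of_int (2 * K + 1)) (Steep False)"
  proof (rule lay_steep[OF refl])
    fix x y assume dom: "x \<in> {0..<int (4 * k - 1)}" "y \<in> {0..<int (4 * k - 1)}"
    have r: "0 \<le> x" "x \<le> 4 * K - 2" "0 \<le> y" "y \<le> 4 * K - 2" using range[OF dom] by simp_all
    define d e where "d = x - (K - 1)" and "e = y - 1"
    have "real_of_int y - (\<nu> - 2) = t * (of_int x - (of_int (K - 1) + \<nu>)) \<longleftrightarrow> of_int e = t * of_int d"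
      unfolding \<nu> by (auto simp: d_def e_def algebra_simps)
    also have "\<dots> \<longleftrightarrow> real_of_int ((2 * K - 1) * e) = of_int ((4 * K - 3) * d)"
      using K by (simp add: t_def field_simps)
    also have "\<dots> \<longleftrightarrow> (2 * K - 1) * e = (4 * K - 3) * d" by (rule of_int_eq_iff)
    also have "\<dots> \<longleftrightarrow> d = 0 \<and> e = 0 \<or> d = 2 * K - 1 \<and> e = 4 * K - 3"
    proof
      assume *: "(2 * K - 1) * e = (4 * K - 3) * d"
      \<comment> \<open>As \<open>4 * K - 3 = 2 * (2 * K - 1) - 1\<close>, the common multiplier is
        now \<open>2 * d - e\<close>.\<close>
      have d: "d = (2 * K - 1) * (2 * d - e)" using * by (simp add: algebra_simps)
      have e: "e = (4 * K - 3) * (2 * d - e)" using * d by (simp add: algebra_simps)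
      have "- (4 * K - 3) < e" "e \<le> 4 * K - 3" using r K by (auto simp: e_def)
      then have "2 * d - e = 0 \<or> 2 * d - e = 1"
        using multiple_unit_interval[of "4 * K - 3" "2 * d - e"] e K by simp
      then show "d = 0 \<and> e = 0 \<or> d = 2 * K - 1 \<and> e = 4 * K - 3" using d e by auto
    qed auto
    also have "\<dots> \<longleftrightarrow> sp x y = Some (Steep False)" using K by (auto simp: sp_def d_def e_def)
    finally have line: "real_of_int y - (\<nu> - 2) = t * (of_int x - (of_int (K - 1) + \<nu>)) \<longleftrightarrow> sp x y = Some (Steep False)" .
    have "of_int (K - 1) \<le> real_of_int x \<and> real_of_int x < of_int (3 * K)" if "sp x y = Some (Steep False)"
      using that K by (auto simp: sp_def split: if_splits)
    moreover have "of_int (K - 1) + \<nu> < of_int (3 * K)" using \<nu>_neg K by simp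
    ultimately show "real_of_int y - (\<nu> - 2) = (if False then s else t) * (of_int x - (of_int (K - 1) + \<nu>)) \<and>
        min (of_int (K - 1) + \<nu>) (of_int (3 * K)) \<le> of_int x \<and> of_int x \<le> max (of_int (K - 1) + \<nu>) (of_int (3 * K)) \<and>
        real_of_int x \<noteq> of_int (3 * K) \<longleftrightarrow> sp x y = Some (Steep False)"
      unfolding if_False line using \<nu>_neg by auto
  next
    show "of_int (K - 1) + \<nu> \<noteq> of_int (3 * K)" using \<nu>_neg K by simp
    show "1 + t * of_int (2 * K + 1) - (\<nu> - 2) = (if False then s else t) * (of_int (3 * K) - (of_int (K - 1) + \<nu>))"
      unfolding \<nu> by (simp add: algebra_simps)
  qed
  have p13: "lay (of_int (3 * K), 1 + t * of_int (2 * K + 1)) (pt (2 * (3 * K)) (2 * (2 - 2 * K))) (Vert (3 * K))"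
    unfolding ptV
  proof (rule lay_vert_full)
    have "t * of_int (2 * K + 1) = of_int (4 * K - 3) + 2 * t" using t_mult by (simp add: algebra_simps)
    moreover have "real (4 * k - 1) = of_int (4 * K - 1)" using k by (simp add: K_def of_nat_diff)
    ultimately show "1 + t * of_int (2 * K + 1) < 0 \<and> real (4 * k - 1) - 1 < of_int (2 - 2 * K) \<or>
        real_of_int (2 - 2 * K) < 0 \<and> real (4 * k - 1) - 1 < 1 + t * of_int (2 * K + 1)"
      using K t_gt by simp
  qed (use K fV in \<open>auto simp: free_vert_def\<close>)
  \<comment> \<open>The edge ends at the top grid point of column \<open>3 * K - 1\<close>, the
    first column to the right of the box; that point is counted for the vertical edge that
    follows.\<close>
  have s1: "lay (pt (2 * K - 3) (4 * K - 5)) (pt (2 * (3 * K - 1)) (2 * (4 * K - 2))) (Rise (1 - K))"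
    by (rule lay_rise_raw) (use K fE[of "1 - K"] in \<open>auto simp: min_def max_def free_rise_def\<close>)
  have s2: "lay (pt (2 * (3 * K - 1)) (2 * (4 * K - 2))) (pt (2 * (3 * K - 1)) (2 * (- 1))) (Vert (3 * K - 1))"
    unfolding ptV
  proof (rule lay_vert)
    fix y assume "y \<in> {0..<int (4 * k - 1)}"
    then have "0 \<le> real_of_int y" "real_of_int y \<le> of_int (4 * K - 2)" by (rule range_real)+
    then show "min (of_int (4 * K - 2)) (of_int (- 1)) \<le> real_of_int y \<and>
        real_of_int y \<le> max (of_int (4 * K - 2)) (of_int (- 1)) \<and> real_of_int y \<noteq> of_int (- 1) \<longleftrightarrow> sp (3 * K - 1) y = None"
      using fV[of "3 * K - 1"] K by (auto simp: free_vert_def min_def max_def)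
  qed (use K in simp_all)
  have s5: "lay (pt (2 * (4 * K - 2)) (2 * (5 * K - 1))) (pt (2 * (4 * K - 2)) (2 * ((4 * K - 2) * (2 - 3 * K)))) (Vert (4 * K - 2))"
    by (rule lay_vert_pt) (use K fV neg in \<open>simp_all add: mult.commute\<close>)
  have s6: "lay (pt (2 * (4 * K - 2)) (2 * ((4 * K - 2) * (2 - 3 * K)))) (pt (2 * K - 3) (3 * (4 * K - 2))) (Steep True)"
    unfolding ptV unfolding pt_def
  proof (rule lay_steep[OF refl])
    fix x y assume dom: "x \<in> {0..<int (4 * k - 1)}" "y \<in> {0..<int (4 * k - 1)}"
    have r: "0 \<le> x" "x \<le> 4 * K - 2" "0 \<le> y" "y \<le> 4 * K - 2" using range[OF dom] by simp_all
    have "real_of_int y - of_int ((4 * K - 2) * (2 - 3 * K)) = s * (of_int x - of_int (4 * K - 2)) \<longleftrightarrow>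
        real_of_int y = of_int ((4 * K - 2) * (K - x))"
      by (simp add: s_def algebra_simps)
    also have "\<dots> \<longleftrightarrow> y = (4 * K - 2) * (K - x)" by (rule of_int_eq_iff)
    also have "\<dots> \<longleftrightarrow> x = K - 1 \<and> y = 4 * K - 2 \<or> x = K \<and> y = 0"
      using multiple_unit_interval[of "4 * K - 2" "K - x"] r K by auto
    also have "\<dots> \<longleftrightarrow> sp x y = Some (Steep True)" by (simp add: sp_def)
    finally have line: "real_of_int y - of_int ((4 * K - 2) * (2 - 3 * K)) = s * (of_int x - of_int (4 * K - 2)) \<longleftrightarrow>
        sp x y = Some (Steep True)" .
    have "K - 1 \<le> x \<and> x \<le> 4 * K - 2" if "sp x y = Some (Steep True)"
      using that K by (auto simp: sp_def split: if_splits)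
    then have "2 * K - 3 < 2 * x \<and> x \<le> 4 * K - 2" if "sp x y = Some (Steep True)" using that by fastforce
    then have "of_int (2 * K - 3) / 2 < real_of_int x \<and> real_of_int x \<le> of_int (4 * K - 2)" if "sp x y = Some (Steep True)"
      using that unfolding int_half_simps of_int_le_iff by blast
    moreover have "real_of_int (2 * K - 3) / 2 < of_int (4 * K - 2)" using K by simp
    ultimately show "real_of_int y - of_int ((4 * K - 2) * (2 - 3 * K)) = (if True then s else t) * (of_int x - of_int (4 * K - 2)) \<and>
        min (of_int (4 * K - 2)) (of_int (2 * K - 3) / 2) \<le> real_of_int x \<and>
        real_of_int x \<le> max (of_int (4 * K - 2)) (of_int (2 * K - 3) / 2) \<and>
        real_of_int x \<noteq> of_int (2 * K - 3) / 2 \<longleftrightarrow> sp x y = Some (Steep True)"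
      unfolding if_True line by auto
  qed (use K in \<open>simp_all add: s_def field_simps\<close>)
  note special = p9 p10 p11 p12 p13 s1 s2 s5 s6
  have pre: "covers (4 * k - 1) \<kappa> (dir s t) u pre pks" "last (u # pre) = pt (2 * (K - 1) - 1) (4 * 2 - 1)"
    unfolding pre_def pks_def u_def covers.simps
     apply (intro conjI TrueI; (rule special)?; (rule lay_rise | rule lay_fall | rule lay_vert_pt);
      use K in \<open>simp add: min_def max_def fE fF fV\<close>)
    by simp
  have suf: "covers (4 * k - 1) \<kappa> (dir s t) (pt (2 * (K - 1) - 1) (4 * (2 + int (k - 3)) - 1)) suf sks"
  proof -
    have start: "pt (2 * (K - 1) - 1) (4 * (2 + int (k - 3)) - 1) = pt (2 * K - 3) (4 * K - 5)" using K by simp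
    show ?thesis
      unfolding start suf_def sks_def covers.simps
      by (intro conjI TrueI; (rule special)?; (rule lay_rise | rule lay_fall | rule lay_vert_pt);
        use K in \<open>simp add: min_def max_def fE fF fV\<close>)
  qed
  have "covers (4 * k - 1) \<kappa> (dir s t) u (pre @ ?mid @ suf) (pks @ mks @ sks)"
    unfolding mks_def
    by (rule covers_sandwich[OF pre covers_body suf]) (use K fE fF fV in auto)
  then have "exact_chain (4 * k - 1) (u # pre @ ?mid @ suf) (2 * (4 * k - 1) - 2)"
  proof (rule exact_chain_covers[where ?x0.0 = "K - 1" and ?y0.0 = 0])
    show "length (pks @ mks @ sks) = 2 * (4 * k - 1) - 2"
      using k by (simp add: mks_def pks_def sks_def)
    show "successively (\<lambda>k l. cross (dir s t k) (dir s t l) \<noteq> 0) (pks @ mks @ sks)"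
      unfolding mks_def
    proof (rule successively_body)
      have "t \<noteq> 1" using t_gt by simp
      then have "cross (dir s t (Rise 1)) (dir s t (Steep False)) \<noteq> 0" by (simp add: dir_def cross_def)
      then show "successively (\<lambda>k l. cross (dir s t k) (dir s t l) \<noteq> 0) pks"
        by (simp add: pks_def cross_dir_simps)
    qed (simp_all add: pks_def sks_def cross_dir_simps)
    show "\<kappa> x y \<in> set (pks @ mks @ sks)" if xy: "x \<in> {0..<int (4 * k - 1)}" "y \<in> {0..<int (4 * k - 1)}" for x y
    proof -
      have r: "0 \<le> x" "x < 4 * K - 1" "0 \<le> y" "y < 4 * K - 1" using range[OF xy] by auto
      show ?thesis
      proof (cases x y rule: \<kappa>_cases)
        case (sp k)
        then show ?thesis by (auto simp: pks_def sks_def sp_def split: if_splits)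
      next
        case Vert
        then have "x = 0 \<or> x = K - 2 \<or> x = 3 * K - 1 \<or> x = 3 * K \<or> x = 4 * K - 2
          \<or> (2 \<le> x - (- 1) \<and> x - (- 1) < K - 1 \<or> 2 \<le> x - (3 * K - 1) \<and> x - (3 * K - 1) < K - 1)"
          using r K(1) by linarith
        then show ?thesis unfolding Vert(2) mks_def
          by (elim disjE) (simp_all add: pks_def sks_def vert_mem_body_keys K)
      next
        case (Rise i)
        have "i \<noteq> 1 - 2 * K"
        proof
          assume "i = 1 - 2 * K"
          then have "x = K - 1 \<and> y = 4 * K - 2" using Rise r by linarith
          then show False using Rise(1) by (simp add: sp_def)
        qed
        then have "i = - 1 \<or> i = 2 - 2 * K \<or> i = 2 \<or> i = 0 \<or> i = 1 \<or> i = - K \<or> i = 1 - K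
          \<or> (2 \<le> - i \<and> - i < K - 1 \<or> 2 \<le> i - 1 \<and> i - 1 < K - 1
          \<or> 2 \<le> i - 1 + 2 * K \<and> i - 1 + 2 * K < K - 1)"
          using Rise r K(1) by linarith
        then show ?thesis unfolding Rise(2) mks_def
          by (elim disjE) (simp_all add: pks_def sks_def rise_mem_body_keys K)
      next
        case (Fall i)
        have "i \<noteq> 1"
        proof
          assume "i = 1"
          then have "x = K - 1 \<and> y = 1 \<or> x = K \<and> y = 0" using Fall r by linarith
          then show False using Fall(1) by (auto simp: sp_def split: if_splits)
        qed
        moreover have "i \<noteq> 3 * K - 1"
        proof
          assume "i = 3 * K - 1"
          then have "x = 3 * K - 2 \<and> y = 4 * K - 2" using Fall r by linarith
          then show False using Fall(1) by (simp add: sp_def split: if_splits)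
        qed
        ultimately have "i = 2 * K + 1 \<or> i = 2 * K - 2 \<or> i = 2 * K \<or> i = 2 * K - 1 \<or> i = 2 \<or> i = K
          \<or> (2 \<le> i - 1 \<and> i - 1 < K - 1 \<or> 2 \<le> 2 * K - 1 - i \<and> 2 * K - 1 - i < K - 1
          \<or> 2 \<le> i - 2 * K \<and> i - 2 * K < K - 1)"
          using Fall r K(1) by linarith
        then show ?thesis unfolding Fall(2) mks_def
          by (elim disjE) (simp_all add: pks_def sks_def fall_mem_body_keys K)
      qed
    qed
    have "s \<noteq> 0" using K by (simp add: s_def)
    then show "snd (dir s t (\<kappa> x 0)) \<noteq> 0" for x using t_gt
      by (simp add: dir_def split: key.splits)
    show "fst (dir s t (\<kappa> (K - 1) y)) \<noteq> 0" for y by (rule fst_dir_\<kappa>) (use K in simp_all)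
    show "last (pre @ ?mid @ suf) \<notin> grid (4 * k - 1)"
      by (auto simp: suf_def pt_grid) presburger
  qed (use k K in auto)
  then show ?thesis by blast
qed

section \<open>Small grids\<close>

definition sc :: "int \<Rightarrow> int \<times> int \<Rightarrow> real \<times> real" where
  "sc D a = (of_int (fst a) / of_int D, of_int (snd a) / of_int D)"

definition icross :: "int \<times> int \<Rightarrow> int \<times> int \<Rightarrow> int" where
  "icross a b = fst a * snd b - snd a * fst b"

text \<open>Bounds on both coordinates spare a case distinction for vertical edges.\<close>

definition on_edge :: "int \<times> int \<Rightarrow> int \<times> int \<Rightarrow> int \<times> int \<Rightarrow> bool" where
  "on_edge a b p \<longleftrightarrow> p \<noteq> b \<and> icross (p - a) (b - a) = 0 \<and>
     min (fst a) (fst b) \<le> fst p \<and> fst p \<le> max (fst a) (fst b) \<and>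
     min (snd a) (snd b) \<le> snd p \<and> snd p \<le> max (snd a) (snd b)"

text \<open>An executable form of \<open>exact_chain\<close>, with all coordinates multiplied by a
  common denominator \<open>D\<close>. The length of the filtered list expresses unique
  existence.\<close>

definition check_chain :: "nat \<Rightarrow> int \<Rightarrow> (int \<times> int) list \<Rightarrow> bool" where
  "check_chain n D ws \<longleftrightarrow>
     (let K = length ws - 1; P = List.product (map (\<lambda>i. D * int i) [0..<n]) (map (\<lambda>i. D * int i) [0..<n]) in
       0 < K \<and>
       (\<forall>i\<in>set [0..<K - 1]. icross (ws ! Suc i - ws ! i) (ws ! Suc (Suc i) - ws ! Suc i) \<noteq> 0) \<and>
       (\<forall>i\<in>set [0..<K]. ws ! i \<noteq> ws ! Suc i) \<and>
       (\<forall>p\<in>set P. length (filter (\<lambda>i. on_edge (ws ! i) (ws ! Suc i) p) [0..<K]) = 1) \<and>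
       (\<forall>i\<in>set [0..<K]. \<exists>p\<in>set P. on_edge (ws ! i) (ws ! Suc i) p) \<and>
       ws ! K \<notin> set P)"

lemma mem_closed_segment_cross:
  fixes p :: "real \<times> real"
  assumes "a \<noteq> b"
  shows "p \<in> closed_segment a b \<longleftrightarrow> cross (p - a) (b - a) = 0 \<and>
     min (fst a) (fst b) \<le> fst p \<and> fst p \<le> max (fst a) (fst b) \<and>
     min (snd a) (snd b) \<le> snd p \<and> snd p \<le> max (snd a) (snd b)"
proof
  assume p: "p \<in> closed_segment a b"
  then have "cross (p - a) (b - a) = 0" using cross_closed_segment[of a a b p] by simp
  moreover have "fst p \<in> closed_segment (fst a) (fst b)" "snd p \<in> closed_segment (snd a) (snd b)"
    using p by (auto simp: in_segment)
  ultimately show "cross (p - a) (b - a) = 0 \<and>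
     min (fst a) (fst b) \<le> fst p \<and> fst p \<le> max (fst a) (fst b) \<and>
     min (snd a) (snd b) \<le> snd p \<and> snd p \<le> max (snd a) (snd b)"
    by (auto simp: closed_segment_eq_real_ivl split: if_splits)
next
  assume R: "cross (p - a) (b - a) = 0 \<and>
     min (fst a) (fst b) \<le> fst p \<and> fst p \<le> max (fst a) (fst b) \<and>
     min (snd a) (snd b) \<le> snd p \<and> snd p \<le> max (snd a) (snd b)"
  show "p \<in> closed_segment a b"
  proof (cases "fst a = fst b")
    case True
    then have "fst p = fst a" using R by auto
    moreover have "snd p \<in> closed_segment (snd a) (snd b)"
      using R by (auto simp: closed_segment_eq_real_ivl min_def max_def split: if_splits)
    moreover have "p = (fst p, snd p)" "a = (fst a, snd a)" "b = (fst a, snd b)"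
      using True by (simp_all add: prod_eq_iff)
    ultimately show ?thesis using mem_closed_segment_vertical by metis
  next
    case False
    define s where "s = (snd b - snd a) / (fst b - fst a)"
    have "snd b - snd a = s * (fst b - fst a)" using False by (simp add: s_def)
    moreover have "snd p - snd a = s * (fst p - fst a)"
      using R False by (auto simp: s_def cross_def field_simps)
    ultimately show ?thesis using mem_closed_segment_slope[OF False] R by blast
  qed
qed

context
  fixes D :: int
  assumes D: "0 < D"
begin

lemma sc_eq_iff: "sc D a = sc D b \<longleftrightarrow> a = b"
  using D by (auto simp: sc_def prod_eq_iff)

lemma cross_sc: "cross (sc D a - sc D b) (sc D c - sc D d) = of_int (icross (a - b) (c - d)) / (of_int D)\<^sup>2"
  using D by (simp add: sc_def cross_def icross_def field_simps power2_eq_square)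

lemma sc_on_edge:
  assumes "a \<noteq> b"
  shows "sc D p \<in> closed_segment (sc D a) (sc D b) \<and> sc D p \<noteq> sc D b \<longleftrightarrow> on_edge a b p"
proof -
  have ne: "sc D a \<noteq> sc D b" using assms sc_eq_iff by simp
  have minmax: "min (of_int x / real_of_int D) (of_int y / of_int D) = of_int (min x y) / of_int D"
    "max (of_int x / real_of_int D) (of_int y / of_int D) = of_int (max x y) / of_int D" for x y
    using D by (auto simp: min_def max_def divide_le_cancel)
  have le: "of_int x / real_of_int D \<le> of_int y / of_int D \<longleftrightarrow> x \<le> y" for x y
    using D by (auto simp: divide_le_cancel)
  show ?thesis
    unfolding mem_closed_segment_cross[OF ne] cross_sc on_edge_def sc_eq_iff
    using D by (simp add: sc_def minmax le del: of_int_min of_int_max) blast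
qed

lemma exact_chain_check:
  assumes check: "check_chain n D ws" and len: "length ws = Suc K"
  shows "exact_chain n (map (sc D) ws) K"
proof -
  have K_def: "K = length ws - 1" using len by simp
  define P where "P = set (List.product (map (\<lambda>i. D * int i) [0..<n]) (map (\<lambda>i. D * int i) [0..<n]))"
  have c: "0 < K" "\<And>i. Suc i < K \<Longrightarrow> icross (ws ! Suc i - ws ! i) (ws ! Suc (Suc i) - ws ! Suc i) \<noteq> 0"
    "\<And>i. i < K \<Longrightarrow> ws ! i \<noteq> ws ! Suc i"
    "\<And>p. p \<in> P \<Longrightarrow> length (filter (\<lambda>i. on_edge (ws ! i) (ws ! Suc i) p) [0..<K]) = 1"
    "\<And>i. i < K \<Longrightarrow> \<exists>p\<in>P. on_edge (ws ! i) (ws ! Suc i) p" "ws ! K \<notin> P"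
    using check unfolding check_chain_def Let_def K_def[symmetric] P_def[symmetric] by auto
  have nth: "map (sc D) ws ! i = sc D (ws ! i)" if "i \<le> K" for i using that len by simp
  have grid: "p \<in> grid n \<longleftrightarrow> (\<exists>q\<in>P. p = sc D q)" for p
  proof
    assume "p \<in> grid n"
    then obtain i j where "p = (real i, real j)" "i < n" "j < n" by (auto simp: grid_def)
    then show "\<exists>q\<in>P. p = sc D q"
      using D by (intro bexI[of _ "(D * int i, D * int j)"]) (auto simp: P_def sc_def)
  next
    assume "\<exists>q\<in>P. p = sc D q"
    then show "p \<in> grid n" using D by (auto simp: grid_def P_def sc_def)
  qed
  have edge: "sc D q \<in> edge (map (sc D) ws) i \<and> sc D q \<noteq> map (sc D) ws ! Suc i \<longleftrightarrow> on_edge (ws ! i) (ws ! Suc i) q"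
    if "i < K" for i q
    using sc_on_edge[OF c(3)[OF that]] that by (simp add: edge_def nth)
  show ?thesis
  proof
    show "\<exists>!i. i < K \<and> p \<in> edge (map (sc D) ws) i \<and> p \<noteq> map (sc D) ws ! Suc i" if p: "p \<in> grid n" for p
    proof -
      obtain q where q: "q \<in> P" "p = sc D q" using p grid by auto
      have "card {i. i < K \<and> on_edge (ws ! i) (ws ! Suc i) q} = 1"
        using c(4)[OF q(1)] by (simp add: length_filter_conv_card cong: conj_cong)
      then obtain j where "{i. i < K \<and> on_edge (ws ! i) (ws ! Suc i) q} = {j}"
        using card_1_singletonE by blast
      then have "i < K \<and> on_edge (ws ! i) (ws ! Suc i) q \<longleftrightarrow> i = j" for i by blast
      moreover have "i < K \<and> p \<in> edge (map (sc D) ws) i \<and> p \<noteq> map (sc D) ws ! Suc i \<longleftrightarrow>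
          i < K \<and> on_edge (ws ! i) (ws ! Suc i) q" for i
        unfolding q(2) using edge[of i q] by blast
      ultimately show ?thesis by simp
    qed
    show "\<exists>p\<in>grid n. p \<in> edge (map (sc D) ws) i \<and> p \<noteq> map (sc D) ws ! Suc i" if "i < K" for i
      using c(5)[OF that] edge[OF that] grid by blast
    show "map (sc D) ws ! K \<notin> grid n" using c(6) by (auto simp: nth grid sc_eq_iff)
    show "cross (map (sc D) ws ! Suc i - map (sc D) ws ! i) (map (sc D) ws ! Suc (Suc i) - map (sc D) ws ! Suc i) \<noteq> 0"
      if "Suc i < K" for i
      using c(2)[OF that] that D by (simp add: nth cross_sc)
    show "map (sc D) ws ! i \<noteq> map (sc D) ws ! Suc i" if "i < K" for i
      using c(3)[OF that] that by (simp add: nth sc_eq_iff)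
  qed (use c(1) len in simp_all)
qed

end

section \<open>Side lengths below the range of the general constructions\<close>

lemma path_1: "\<exists>vs. exact_chain 1 vs 1"
proof -
  let ?ws = "[(0, 0), (1, 0)]"
  have "check_chain 1 1 ?ws" by code_simp
  then have "exact_chain 1 (map (sc 1) ?ws) 1" by (rule exact_chain_check[rotated]) simp_all
  then show ?thesis by blast
qed

lemma cycle_2: "\<exists>vs. exact_chain 2 vs 3 \<and> hd vs = last vs"
proof -
  let ?ws = "[(- 2, 0), (4, 0), (1, 3), (- 2, 0)]"
  have "check_chain 2 2 ?ws" by code_simp
  then have "exact_chain 2 (map (sc 2) ?ws) 3" by (rule exact_chain_check[rotated]) simp_all
  then show ?thesis by (intro exI[of _ "map (sc 2) ?ws"]) simp
qed

lemma path_3: "\<exists>vs. exact_chain 3 vs 4"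
proof -
  let ?ws = "[(4, 4), (0, 0), (0, 6), (6, 0), (1, 0)]"
  have "check_chain 3 2 ?ws" by code_simp
  then have "exact_chain 3 (map (sc 2) ?ws) 4" by (rule exact_chain_check[rotated]) simp_all
  then show ?thesis by blast
qed

lemma cycle_4: "\<exists>vs. exact_chain 4 vs 6 \<and> hd vs = last vs"
proof -
  let ?ws = "[(- 2, - 2), (8, 8), (- 2, 3), (8, - 2), (- 2, 8), (8, 3), (- 2, - 2)]"
  have "check_chain 4 2 ?ws" by code_simp
  then have "exact_chain 4 (map (sc 2) ?ws) 6" by (rule exact_chain_check[rotated]) simp_all
  then show ?thesis by (intro exI[of _ "map (sc 2) ?ws"]) simp
qed

lemma path_5: "\<exists>vs. exact_chain 5 vs 8"
proof -
  let ?ws = "[(0, 2), (0, - 4), (5, 6), (0, 6), (6, 0), (6, 8), (- 4, 8), (8, - 4), (8, 10)]"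
  have "check_chain 5 2 ?ws" by code_simp
  then have "exact_chain 5 (map (sc 2) ?ws) 8" by (rule exact_chain_check[rotated]) simp_all
  then show ?thesis by blast
qed

lemma path_7: "\<exists>vs. exact_chain 7 vs 12"
proof -
  let ?ws = "[(10, 20), (50, 60), (50, - 10), (5, 35), (60, 90), (60, - 240), (8, 72), (45, 35), (0,
      - 10), (0, 60), (45, 15), (- 35, - 65), (43, 65)]"
  have "check_chain 7 10 ?ws" by code_simp
  then have "exact_chain 7 (map (sc 10) ?ws) 12" by (rule exact_chain_check[rotated]) simp_all
  then show ?thesis by blast
qed

section \<open>Optimal chains\<close>

lemma min_link_length_exact_chain:
  assumes "exact_chain n vs (min_links n)"
  shows "min_link_length n = min_links n"
proof -
  interpret exact_chain n vs "min_links n" by fact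
  show ?thesis
    unfolding min_link_length_def
  proof (rule Least_equality)
    show "\<exists>vs. covering_trail n vs \<and> link_length vs = min_links n"
      using covering_trail link_length by blast
    show "min_links n \<le> j" if "\<exists>vs. covering_trail n vs \<and> link_length vs = j" for j
      using that min_links_le by blast
  qed
qed

lemma covering_path_exists:
  assumes "\<exists>vs. exact_chain n vs (min_links n)"
  shows "\<exists>vs. covering_path n vs \<and> link_length vs = min_link_length n"
  using assms min_link_length_exact_chain exact_chain.covering_path exact_chain.link_length by metis

lemma covering_cycle_exists:
  assumes "\<exists>vs. exact_chain n vs (min_links n) \<and> hd vs = last vs"
  shows "\<exists>vs. covering_cycle n vs \<and> link_length vs = min_link_length n"
  using assms min_link_length_exact_chain exact_chain.covering_cycle exact_chain.link_length by metis

lemma even_cycle: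
  assumes "0 < m"
  shows "\<exists>vs. exact_chain (2 * m) vs (min_links (2 * m)) \<and> hd vs = last vs"
proof -
  have "m = 1 \<or> m = 2 \<or> (\<exists>k\<ge>2. m = 2 * k) \<or> (\<exists>k\<ge>1. m = 2 * k + 1)" using assms by presburger
  then consider "m = 1" | "m = 2" | k where "2 \<le> k" "m = 2 * k" | k where "1 \<le> k" "m = 2 * k + 1" by blast
  then show ?thesis
  proof cases
    case 1
    then show ?thesis using cycle_2 by (simp add: min_links_def)
  next
    case 2
    then show ?thesis using cycle_4 by (simp add: min_links_def)
  next
    case 3
    then show ?thesis using cycle_4k[of k] by (simp add: min_links_ge_3)
  next
    case 4
    then show ?thesis using cycle_4k2[of k] by (simp add: min_links_ge_3)
  qed
qed

lemma odd_path:
  assumes "odd n"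
  shows "\<exists>vs. exact_chain n vs (min_links n)"
proof -
  have "n = 1 \<or> n = 3 \<or> n = 5 \<or> n = 7 \<or> (\<exists>k\<ge>2. n = 4 * k + 1) \<or> (\<exists>k\<ge>3. n = 4 * k - 1)"
    using assms by presburger
  then consider "n = 1" | "n = 3" | "n = 5" | "n = 7" | k where "2 \<le> k" "n = 4 * k + 1"
    | k where "3 \<le> k" "n = 4 * k - 1" by blast
  then show ?thesis
  proof cases
    case 1
    then show ?thesis using path_1 by (simp add: min_links_def)
  next
    case 2
    then show ?thesis using path_3 by (simp add: min_links_def)
  next
    case 3
    then show ?thesis using path_5 by (simp add: min_links_def)
  next
    case 4
    then show ?thesis using path_7 by (simp add: min_links_def)
  next
    case 5
    then show ?thesis using path_4k1[of k] by (simp add: min_links_ge_3)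
  next
    case 6
    then show ?thesis using path_4k3[of k] by (simp add: min_links_ge_3)
  qed
qed

theorem theorem2p1:
  fixes n :: nat
  assumes "n > 0"
  shows "(\<exists>vs. covering_path n vs \<and> link_length vs = min_link_length n) \<and>
         (\<forall>m::nat. m > 0 \<and> n = 2 * m \<longrightarrow>
            (\<exists>vs. covering_cycle n vs \<and> link_length vs = min_link_length n))"
proof (intro conjI allI impI)
  show "\<exists>vs. covering_path n vs \<and> link_length vs = min_link_length n"
  proof (cases "even n")
    case True
    then obtain m where "n = 2 * m" by blast
    \<comment> \<open>The cycle starts and ends off the grid and passes each grid point once, so it
      is also a covering path.\<close>
    then show ?thesis using assms even_cycle[of m] by (intro covering_path_exists) auto
  next
    case False
    then show ?thesis using odd_path by (intro covering_path_exists)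
  qed
next
  fix m :: nat assume "m > 0 \<and> n = 2 * m"
  then show "\<exists>vs. covering_cycle n vs \<and> link_length vs = min_link_length n"
    using even_cycle[of m] by (intro covering_cycle_exists) simp
qed

end
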